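(* Let $\Omega\subset\mathbb{R}^n$ ($n\ge 1$) be a bounded domain with smooth boundary $\partial\Omega$ and unit exterior normal $\nu$. Let $f,g:[0,\infty)\to[0,\infty)$ and $\alpha,\beta:[0,\infty)\to[0,\infty)$ be continuous, and let $u_0\in C^1(\overline\Omega)$, $u_0\ge 0$ in $\overline\Omega$, satisfy $\partial u_0/\partial\nu=\beta(0)g(u_0)$ on $\partial\Omega$. Suppose that $g(s)$ is a nondecreasing positive function for $s>0$ such that $$\int^{+\infty}\frac{ds}{g(s)}<+\infty \qquad\text{and}\qquad \int_0^{+\infty}\beta(t)\,dt=+\infty .$$ Then any nontrivial nonnegative solution of the problem $$u_t=\Delta u+\alpha(t)f(u)\ \text{ for } x\in\Omega,\ t>0,$$ $$\frac{\partial u(x,t)}{\partial\nu}=\beta(t)g(u)\ \text{ for } x\in\partial\Omega,\ t>0,$$ $$u(x,0)=u_0(x)\ \text{ for } x\in\Omega,$$ blows up in finite time.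
   Context: The notation $\int^{+\infty} ds/g(s)<+\infty$ means that $\int_a^{+\infty} ds/g(s)<+\infty$ for some (equivalently, every) $a>0$. For $T>0$ put $Q_T=\Omega\times(0,T)$, $S_T=\partial\Omega\times(0,T)$, $\Gamma_T=S_T\cup(\overline\Omega\times\{0\})$. Solutions are nonnegative classical solutions: a solution in $Q_T$ is a nonnegative function $u\in C^{2,1}(Q_T)\cap C^{1,0}(Q_T\cup\Gamma_T)$ satisfying the equation in $Q_T$, the boundary condition on $S_T$ and the initial condition. "Nontrivial" means that $u$ is not identically zero (the initial datum $u_0$ itself is allowed to be identically zero). "Any nontrivial nonnegative solution blows up in finite time" means that there is no nontrivial nonnegative classical solution that exists in $Q_T$ for every $T>0$ (i.e. on $\Omega\times(0,\infty)$). *)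

theory Defs
  imports "HOL-Analysis.Analysis"
begin

section \<open>Bounded domains with smooth boundary\<close>

primrec Ck :: "nat \<Rightarrow> ('a::euclidean_space \<Rightarrow> real) \<Rightarrow> bool" where
  "Ck 0 f \<longleftrightarrow> continuous_on UNIV f"
| "Ck (Suc k) f \<longleftrightarrow> (\<forall>x. f differentiable at x) \<and>
     (\<forall>b\<in>Basis. Ck k (\<lambda>x. frechet_derivative f (at x) b))"

definition smooth :: "('a::euclidean_space \<Rightarrow> real) \<Rightarrow> bool" where
  "smooth f \<longleftrightarrow> (\<forall>k. Ck k f)"

text \<open>Near \<open>p\<close>, and after a rotation taking the unit vector \<open>e\<close> to the last coordinate
  direction, the set is the part of the ball lying strictly below the graph of a smooth function
  of the other \<open>n - 1\<close> coordinates. A function on the hyperplane orthogonal to \<open>e\<close> is encoded as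
  a function on the whole space that is constant along \<open>e\<close>; for \<open>n = 1\<close> it is a constant.\<close>

definition boundary_chart ::
    "'a::euclidean_space set \<Rightarrow> 'a \<Rightarrow> real \<Rightarrow> 'a \<Rightarrow> ('a \<Rightarrow> real) \<Rightarrow> bool" where
  "boundary_chart \<Omega> p r e \<gamma> \<longleftrightarrow>
     0 < r \<and> norm e = 1 \<and> smooth \<gamma> \<and> (\<forall>x s. \<gamma> (x + s *\<^sub>R e) = \<gamma> x) \<and>
     \<Omega> \<inter> ball p r = {x \<in> ball p r. x \<bullet> e < \<gamma> x}"

definition smooth_boundary :: "'a::euclidean_space set \<Rightarrow> bool" where
  "smooth_boundary \<Omega> \<longleftrightarrow> (\<forall>p\<in>frontier \<Omega>. \<exists>r e \<gamma>. boundary_chart \<Omega> p r e \<gamma>)"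

definition bounded_smooth_domain :: "'a::euclidean_space set \<Rightarrow> bool" where
  "bounded_smooth_domain \<Omega> \<longleftrightarrow>
     open \<Omega> \<and> connected \<Omega> \<and> \<Omega> \<noteq> {} \<and> bounded \<Omega> \<and> smooth_boundary \<Omega>"

definition gradient :: "('a::euclidean_space \<Rightarrow> real) \<Rightarrow> 'a \<Rightarrow> 'a" where
  "gradient f x = (\<Sum>b\<in>Basis. frechet_derivative f (at x) b *\<^sub>R b)"

text \<open>The normalised gradient at \<open>p\<close> of the function \<open>x \<bullet> e - \<gamma> x\<close>, which is negative
  inside and positive outside the set.\<close>

definition chart_normal :: "'a::euclidean_space \<Rightarrow> 'a \<Rightarrow> ('a \<Rightarrow> real) \<Rightarrow> 'a" where
  "chart_normal p e \<gamma> = sgn (e - gradient \<gamma> p)"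

text \<open>The choice of the chart is immaterial, see \<open>unit_exterior_normal_eq\<close> below.\<close>

definition unit_exterior_normal :: "'a::euclidean_space set \<Rightarrow> 'a \<Rightarrow> 'a" where
  "unit_exterior_normal \<Omega> p =
     (SOME \<nu>. \<exists>r e \<gamma>. boundary_chart \<Omega> p r e \<gamma> \<and> \<nu> = chart_normal p e \<gamma>)"

lemma boundary_chart_derivative:
  assumes "open \<Omega>" "p \<in> frontier \<Omega>" "boundary_chart \<Omega> p r e \<gamma>"
  shows "((\<lambda>x. x \<bullet> e - \<gamma> x) has_derivative (\<lambda>h. h \<bullet> (e - gradient \<gamma> p))) (at p)"
    and "p \<bullet> e = \<gamma> p" and "e - gradient \<gamma> p \<noteq> 0"
proof -
  have r: "0 < r" and e: "norm e = 1" and sm: "smooth \<gamma>"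
    and inv: "\<And>x s. \<gamma> (x + s *\<^sub>R e) = \<gamma> x"
    and eq: "\<Omega> \<inter> ball p r = {x \<in> ball p r. x \<bullet> e < \<gamma> x}"
    using assms(3) by (auto simp: boundary_chart_def)
  have dif: "\<gamma> differentiable at x" for x
    using sm[unfolded smooth_def, THEN spec, of "Suc 0"] by simp
  let ?D = "frechet_derivative \<gamma> (at p)"
  have D: "(\<gamma> has_derivative ?D) (at p)"
    using dif[of p] by (simp add: frechet_derivative_works)
  have lin: "linear ?D" by (rule has_derivative_linear[OF D])
  have Dh: "?D h = h \<bullet> gradient \<gamma> p" for h
  proof -
    have "?D h = ?D (\<Sum>b\<in>Basis. (h \<bullet> b) *\<^sub>R b)" by (simp add: euclidean_representation)
    also have "\<dots> = (\<Sum>b\<in>Basis. (h \<bullet> b) * ?D b)"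
      by (simp add: linear_sum[OF lin] linear_cmul[OF lin])
    also have "\<dots> = h \<bullet> gradient \<gamma> p"
      by (simp add: gradient_def inner_sum_right mult.commute)
    finally show ?thesis .
  qed
  show "((\<lambda>x. x \<bullet> e - \<gamma> x) has_derivative (\<lambda>h. h \<bullet> (e - gradient \<gamma> p))) (at p)"
    using has_derivative_diff[OF has_derivative_inner_left[OF has_derivative_ident] D]
    by (simp add: Dh inner_diff_right)
  have cont: "continuous_on UNIV \<gamma>"
    using dif differentiable_imp_continuous_on[of \<gamma> UNIV] by (simp add: differentiable_on_def)
  have pn: "p \<notin> \<Omega>" "p \<in> closure \<Omega>"
    using assms(1,2) by (auto simp: frontier_def interior_open)
  have "p \<notin> {x \<in> ball p r. x \<bullet> e < \<gamma> x}" using pn(1) eq by blast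
  then have "\<not> p \<bullet> e < \<gamma> p" using r by simp
  moreover have "\<not> \<gamma> p < p \<bullet> e"
  proof
    assume *: "\<gamma> p < p \<bullet> e"
    have "open {x. \<gamma> x < x \<bullet> e}"
      by (intro open_Collect_less cont continuous_intros)
    then have "open ({x. \<gamma> x < x \<bullet> e} \<inter> ball p r)" by auto
    moreover have "p \<in> {x. \<gamma> x < x \<bullet> e} \<inter> ball p r" using * r by simp
    ultimately obtain x where "x \<in> \<Omega>" "x \<in> {x. \<gamma> x < x \<bullet> e} \<inter> ball p r"
      using pn(2) unfolding closure_iff_nhds_not_empty by blast
    then have "x \<in> {x \<in> ball p r. x \<bullet> e < \<gamma> x}" "\<gamma> x < x \<bullet> e" using eq by blast+
    then show False by simp
  qed
  ultimately show "p \<bullet> e = \<gamma> p" by linarith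
  have "((\<lambda>s. \<gamma> (p + s *\<^sub>R e)) has_derivative (\<lambda>s. ?D (s *\<^sub>R e))) (at 0)"
    by (rule has_derivative_compose[where f = "\<lambda>s. p + s *\<^sub>R e" and g = \<gamma>])
       (auto intro!: has_derivative_add_const has_derivative_scaleR_left D simp: add.commute[of p])
  then have "((\<lambda>s. \<gamma> p) has_derivative (\<lambda>s. ?D (s *\<^sub>R e))) (at 0)" by (simp add: inv)
  then have "(\<lambda>s. ?D (s *\<^sub>R e)) = (\<lambda>s. 0)"
    by (rule has_derivative_unique) (rule has_derivative_const)
  then have "?D (1 *\<^sub>R e) = 0" by (rule fun_cong)
  then have "e \<bullet> (e - gradient \<gamma> p) = 1"
    using e by (simp add: Dh inner_diff_right norm_eq_1)
  then show "e - gradient \<gamma> p \<noteq> 0" by auto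
qed

lemma chart_normal_unique:
  assumes "open \<Omega>" "p \<in> frontier \<Omega>" "boundary_chart \<Omega> p r e \<gamma>" "boundary_chart \<Omega> p r' e' \<gamma>'"
  shows "chart_normal p e \<gamma> = chart_normal p e' \<gamma>'"
proof -
  note c = boundary_chart_derivative[OF assms(1,2,3)]
  note c' = boundary_chart_derivative[OF assms(1,2,4)]
  define N where "N = e - gradient \<gamma> p"
  define N' where "N' = e' - gradient \<gamma>' p"
  have neg: "h \<bullet> N' \<le> 0" if h: "h \<bullet> N < 0" for h
  proof (rule ccontr)
    assume "\<not> h \<bullet> N' \<le> 0"
    then have h': "h \<bullet> N' > 0" by simp
    have line: "((\<lambda>t. (p + t *\<^sub>R h) \<bullet> v - k (p + t *\<^sub>R h)) has_real_derivative h \<bullet> M) (at 0)"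
      if "((\<lambda>x. x \<bullet> v - k x) has_derivative (\<lambda>h. h \<bullet> M)) (at p)" for v k M
    proof -
      have "((\<lambda>t. (p + t *\<^sub>R h) \<bullet> v - k (p + t *\<^sub>R h)) has_derivative
              (\<lambda>t. (t *\<^sub>R h) \<bullet> M)) (at 0)"
        by (rule has_derivative_compose[where f = "\<lambda>t. p + t *\<^sub>R h" and g = "\<lambda>x. x \<bullet> v - k x"])
           (auto intro!: has_derivative_add_const has_derivative_scaleR_left that simp: add.commute[of p])
      then show ?thesis
        by (simp add: has_field_derivative_def mult.commute[of _ "h \<bullet> M"])
    qed
    obtain d where d: "d > 0"
      and dn: "\<And>t. 0 < t \<Longrightarrow> t < d \<Longrightarrow> (p + t *\<^sub>R h) \<bullet> e - \<gamma> (p + t *\<^sub>R h) < 0"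
      using has_real_derivative_neg_dec_right[OF line[OF c(1)]] h c(2) unfolding N_def by auto
    obtain d' where d': "d' > 0"
      and dp: "\<And>t. 0 < t \<Longrightarrow> t < d' \<Longrightarrow> 0 < (p + t *\<^sub>R h) \<bullet> e' - \<gamma>' (p + t *\<^sub>R h)"
      using has_real_derivative_pos_inc_right[OF line[OF c'(1)]] h' c'(2) unfolding N'_def by auto
    have rr: "r > 0" "r' > 0" using assms(3,4) by (auto simp: boundary_chart_def)
    have nh: "norm h + 1 > 0" using norm_ge_zero[of h] by linarith
    have "0 < Min {d, d', r / (norm h + 1), r' / (norm h + 1)}" using d d' rr nh by simp
    from dense[OF this] obtain t where t: "0 < t" "t < d" "t < d'"
      "t < r / (norm h + 1)" "t < r' / (norm h + 1)"
      by auto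
    have "t * (norm h + 1) < r" "t * (norm h + 1) < r'"
      using t nh by (auto simp: field_simps)
    then have "t * norm h < r" "t * norm h < r'" using t(1) by (auto simp: algebra_simps)
    then have b: "p + t *\<^sub>R h \<in> ball p r" "p + t *\<^sub>R h \<in> ball p r'"
      using t(1) by (auto simp: dist_norm)
    have "p + t *\<^sub>R h \<in> \<Omega> \<inter> ball p r"
      using assms(3) b(1) dn[OF t(1,2)] by (auto simp: boundary_chart_def)
    then have "p + t *\<^sub>R h \<in> \<Omega> \<inter> ball p r'" using b(2) by simp
    then have "p + t *\<^sub>R h \<in> {x \<in> ball p r'. x \<bullet> e' < \<gamma>' x}"
      using assms(4) unfolding boundary_chart_def by blast
    then show False using dp[OF t(1,3)] by simp
  qed
  have neg0: "h \<bullet> N' \<le> 0" if h: "h \<bullet> N \<le> 0" for h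
  proof (rule ccontr)
    assume "\<not> h \<bullet> N' \<le> 0"
    then have h': "h \<bullet> N' > 0" by simp
    have NN: "N \<bullet> N > 0" using c(3) N_def by simp
    define s where "s = (h \<bullet> N') / (2 * (\<bar>N \<bullet> N'\<bar> + 1))"
    have s: "s > 0" using h' by (simp add: s_def add_pos_nonneg)
    have "(h - s *\<^sub>R N) \<bullet> N < 0"
      using h mult_pos_pos[OF s NN] by (simp add: inner_diff_left)
    then have "(h - s *\<^sub>R N) \<bullet> N' \<le> 0" by (rule neg)
    then have "h \<bullet> N' \<le> s * (N \<bullet> N')" by (simp add: inner_diff_left)
    also have "\<dots> \<le> s * (\<bar>N \<bullet> N'\<bar> + 1)" using s by (intro mult_left_mono) auto
    also have "\<dots> = (h \<bullet> N') / 2" by (simp add: s_def field_simps)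
    finally show False using h' by simp
  qed
  have NN: "N \<bullet> N > 0" "N' \<bullet> N' > 0" using c(3) c'(3) by (auto simp: N_def N'_def)
  have pos: "N \<bullet> N' \<ge> 0" using neg0[of "- N"] NN by simp
  have "((N \<bullet> N) *\<^sub>R N' - (N \<bullet> N') *\<^sub>R N) \<bullet> N' \<le> 0"
    by (rule neg0) (simp add: inner_diff_left inner_commute[of N' N])
  then have "(N \<bullet> N) * (N' \<bullet> N') \<le> (N \<bullet> N') * (N \<bullet> N')" by (simp add: inner_diff_left)
  then have "(norm N * norm N')\<^sup>2 \<le> (N \<bullet> N')\<^sup>2"
    unfolding power_mult_distrib power2_norm_eq_inner by (simp add: power2_eq_square)
  then have "norm N * norm N' \<le> N \<bullet> N'" using pos by (rule power2_le_imp_le)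
  then have "N \<bullet> N' = norm N * norm N'" using norm_cauchy_schwarz[of N N'] by linarith
  then have "norm N *\<^sub>R N' = norm N' *\<^sub>R N" by (simp add: norm_cauchy_schwarz_eq)
  then have "sgn (norm N *\<^sub>R N') = sgn (norm N' *\<^sub>R N)" by simp
  moreover have "norm N > 0" "norm N' > 0" using NN by auto
  ultimately have "sgn N = sgn N'" by (simp add: sgn_scaleR)
  then show ?thesis by (simp add: chart_normal_def N_def N'_def)
qed

lemma unit_exterior_normal_eq:
  assumes "open \<Omega>" "p \<in> frontier \<Omega>" "boundary_chart \<Omega> p r e \<gamma>"
  shows "unit_exterior_normal \<Omega> p = chart_normal p e \<gamma>"
  unfolding unit_exterior_normal_def
  by (rule some_equality) (use assms chart_normal_unique[OF assms(1,2)] in blast)+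

section \<open>Function spaces\<close>

text \<open>On the closure of a smooth domain, having a derivative relative to the closure at every point
  with continuous partial derivatives is the same as having first derivatives in the interior that
  extend continuously to the closure; the relative derivative is unique there.\<close>

definition C1_closure :: "'a::euclidean_space set \<Rightarrow> ('a \<Rightarrow> real) \<Rightarrow> bool" where
  "C1_closure \<Omega> v \<longleftrightarrow>
     (\<forall>x\<in>closure \<Omega>. v differentiable (at x within closure \<Omega>)) \<and>
     (\<forall>b\<in>Basis. continuous_on (closure \<Omega>)
        (\<lambda>x. frechet_derivative v (at x within closure \<Omega>) b))"

definition normal_derivative :: "'a::euclidean_space set \<Rightarrow> ('a \<Rightarrow> real) \<Rightarrow> 'a \<Rightarrow> real" where
  "normal_derivative \<Omega> v x =
     frechet_derivative v (at x within closure \<Omega>) (unit_exterior_normal \<Omega> x)"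

definition cylinder :: "'a::euclidean_space set \<Rightarrow> real \<Rightarrow> ('a \<times> real) set" where
  "cylinder \<Omega> T = \<Omega> \<times> {0<..<T}"

definition lateral_boundary :: "'a::euclidean_space set \<Rightarrow> real \<Rightarrow> ('a \<times> real) set" where
  "lateral_boundary \<Omega> T = frontier \<Omega> \<times> {0<..<T}"

definition parabolic_boundary :: "'a::euclidean_space set \<Rightarrow> real \<Rightarrow> ('a \<times> real) set" where
  "parabolic_boundary \<Omega> T = lateral_boundary \<Omega> T \<union> closure \<Omega> \<times> {0}"

abbreviation dt :: "('a::euclidean_space \<Rightarrow> real \<Rightarrow> real) \<Rightarrow> 'a \<Rightarrow> real \<Rightarrow> real" where
  "dt u x t \<equiv> deriv (\<lambda>s. u x s) t"

definition dx :: "'a \<Rightarrow> ('a::euclidean_space \<Rightarrow> real \<Rightarrow> real) \<Rightarrow> 'a \<Rightarrow> real \<Rightarrow> real" where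
  "dx b u x t = frechet_derivative (\<lambda>y. u y t) (at x) b"

definition laplacian :: "('a::euclidean_space \<Rightarrow> real \<Rightarrow> real) \<Rightarrow> 'a \<Rightarrow> real \<Rightarrow> real" where
  "laplacian u x t = (\<Sum>b\<in>Basis. dx b (dx b u) x t)"

definition C21 :: "'a::euclidean_space set \<Rightarrow> real \<Rightarrow> ('a \<Rightarrow> real \<Rightarrow> real) \<Rightarrow> bool" where
  "C21 \<Omega> T u \<longleftrightarrow>
     (\<forall>(x, t)\<in>cylinder \<Omega> T.
        (\<lambda>s. u x s) differentiable at t \<and>
        (\<lambda>y. u y t) differentiable at x \<and>
        (\<forall>b\<in>Basis. (\<lambda>y. dx b u y t) differentiable at x)) \<and>
     continuous_on (cylinder \<Omega> T) (\<lambda>(x, t). u x t) \<and>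
     continuous_on (cylinder \<Omega> T) (\<lambda>(x, t). dt u x t) \<and>
     (\<forall>b\<in>Basis. continuous_on (cylinder \<Omega> T) (\<lambda>(x, t). dx b u x t)) \<and>
     (\<forall>b\<in>Basis. \<forall>c\<in>Basis. continuous_on (cylinder \<Omega> T) (\<lambda>(x, t). dx c (dx b u) x t))"

definition C10 :: "'a::euclidean_space set \<Rightarrow> real \<Rightarrow> ('a \<Rightarrow> real \<Rightarrow> real) \<Rightarrow> bool" where
  "C10 \<Omega> T u \<longleftrightarrow>
     (\<forall>(x, t)\<in>cylinder \<Omega> T \<union> parabolic_boundary \<Omega> T.
        (\<lambda>y. u y t) differentiable (at x within closure \<Omega>)) \<and>
     continuous_on (cylinder \<Omega> T \<union> parabolic_boundary \<Omega> T) (\<lambda>(x, t). u x t) \<and>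
     (\<forall>b\<in>Basis. continuous_on (cylinder \<Omega> T \<union> parabolic_boundary \<Omega> T)
        (\<lambda>(x, t). frechet_derivative (\<lambda>y. u y t) (at x within closure \<Omega>) b))"

section \<open>Nonnegative classical solutions\<close>

definition nonneg_classical_solution ::
    "'a::euclidean_space set \<Rightarrow> (real \<Rightarrow> real) \<Rightarrow> (real \<Rightarrow> real) \<Rightarrow> (real \<Rightarrow> real) \<Rightarrow> (real \<Rightarrow> real) \<Rightarrow>
     ('a \<Rightarrow> real) \<Rightarrow> real \<Rightarrow> ('a \<Rightarrow> real \<Rightarrow> real) \<Rightarrow> bool" where
  "nonneg_classical_solution \<Omega> f g \<alpha> \<beta> u0 T u \<longleftrightarrow>
     C21 \<Omega> T u \<and> C10 \<Omega> T u \<and>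
     (\<forall>(x, t)\<in>cylinder \<Omega> T \<union> parabolic_boundary \<Omega> T. 0 \<le> u x t) \<and>
     (\<forall>(x, t)\<in>cylinder \<Omega> T. dt u x t = laplacian u x t + \<alpha> t * f (u x t)) \<and>
     (\<forall>(x, t)\<in>lateral_boundary \<Omega> T.
        normal_derivative \<Omega> (\<lambda>y. u y t) x = \<beta> t * g (u x t)) \<and>
     (\<forall>x\<in>\<Omega>. u x 0 = u0 x)"

definition global_nonneg_classical_solution ::
    "'a::euclidean_space set \<Rightarrow> (real \<Rightarrow> real) \<Rightarrow> (real \<Rightarrow> real) \<Rightarrow> (real \<Rightarrow> real) \<Rightarrow> (real \<Rightarrow> real) \<Rightarrow>
     ('a \<Rightarrow> real) \<Rightarrow> ('a \<Rightarrow> real \<Rightarrow> real) \<Rightarrow> bool" where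
  "global_nonneg_classical_solution \<Omega> f g \<alpha> \<beta> u0 u \<longleftrightarrow>
     (\<forall>T>0. nonneg_classical_solution \<Omega> f g \<alpha> \<beta> u0 T u)"

definition nontrivial :: "'a::euclidean_space set \<Rightarrow> ('a \<Rightarrow> real \<Rightarrow> real) \<Rightarrow> bool" where
  "nontrivial \<Omega> u \<longleftrightarrow> (\<exists>x\<in>closure \<Omega>. \<exists>t\<ge>0. u x t \<noteq> 0)"

end

theory Submission
  imports Defs
begin

text \<open>The classical argument integrates \<open>G(u)\<close>, where \<open>G(s) = \<integral>\<^sub>s\<^sup>\<infinity> dr/g(r)\<close>, over the
  domain and uses the divergence theorem. Here that theorem is replaced by a maximum principle: with
  \<open>F' = 1/g\<close>, so that \<open>F\<close> is concave and bounded above, the time integral of \<open>F(u)\<close> over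
  \<open>[t0,T]\<close> has Laplacian bounded above by the total increase of \<open>F(u)\<close>, hence by a constant
  independent of \<open>T\<close>, whereas its normal derivative is \<open>\<integral> \<beta>\<close>, which is
  unbounded in \<open>T\<close>. Subtracting
  \<open>\<epsilon> |x|\<^sup>2 \<integral> \<beta>\<close> with a small \<open>\<epsilon>\<close> and minimising shows that the two
  are incompatible. The division by \<open>g(u)\<close> needs \<open>u > 0\<close> up to the boundary from some time
  on, which follows from a comparison with explicit subsolutions in balls, those centred slightly
  inside a boundary point included.\<close>

section \<open>One-dimensional calculus\<close>

text \<open>Since \<open>f' 0 = 0\<close>, a negative \<open>D\<close> would make \<open>f'\<close>
  negative just to the right of 0, and the mean value theorem would put \<open>f\<close> below its
  minimum.\<close>

lemma second_derivative_nonneg_at_min: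
  fixes f f' :: "real \<Rightarrow> real"
  assumes "0 < d"
    and f: "\<And>s. \<bar>s\<bar> < d \<Longrightarrow> (f has_real_derivative f' s) (at s)"
    and f': "(f' has_real_derivative D) (at 0)"
    and min: "\<And>s. \<bar>s\<bar> < d \<Longrightarrow> f 0 \<le> f s"
  shows "0 \<le> D"
proof (rule ccontr)
  assume "\<not> 0 \<le> D"
  then have "D < 0" by simp
  have "f' 0 = 0"
    using DERIV_local_min[OF f[of 0] \<open>0 < d\<close>] min \<open>0 < d\<close> by auto
  moreover obtain e where "e > 0" and e: "\<And>h. 0 < h \<Longrightarrow> h < e \<Longrightarrow> f' (0 + h) < f' 0"
    using DERIV_neg_dec_right[OF f' \<open>D < 0\<close>] by auto
  ultimately have neg: "f' h < 0" if "0 < h" "h < e" for h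
    using that by fastforce
  define s where "s = min d e / 2"
  have s: "0 < s" "s < d" "s < e"
    using \<open>0 < d\<close> \<open>0 < e\<close> by (auto simp: s_def)
  have "\<exists>z>0. z < s \<and> f s - f 0 = (s - 0) * f' z"
    by (rule MVT2[OF s(1)]) (use s in \<open>auto intro!: f\<close>)
  then obtain z where "0 < z" "z < s" "f s - f 0 = s * f' z"
    by auto
  then have "f s < f 0"
    using neg[of z] s mult_pos_neg[of s "f' z"] by simp
  with min[of s] s show False by auto
qed

text \<open>First-order condition for minima where only one direction is admissible: inward at the
  boundary, backward in time.\<close>

lemma one_sided_derivative_nonneg:
  fixes f :: "real \<Rightarrow> real"
  assumes "0 < d" "(f has_real_derivative D) (at 0 within {0..d})"
    and "\<And>s. 0 \<le> s \<Longrightarrow> s \<le> d \<Longrightarrow> f 0 \<le> f s"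
  shows "0 \<le> D"
proof (rule ccontr)
  assume "\<not> 0 \<le> D"
  then obtain e where "e > 0" and e: "\<forall>h>0. 0 + h \<in> {0..d} \<longrightarrow> h < e \<longrightarrow> f 0 > f (0 + h)"
    using has_real_derivative_neg_dec_right[OF assms(2)] by (auto simp: not_le)
  define h where "h = min d e / 2"
  have "0 < h" "h \<le> d" "h < e"
    using \<open>0 < d\<close> \<open>0 < e\<close> by (auto simp: h_def)
  then show False using e assms(3)[of h] by fastforce
qed

text \<open>Meant for \<open>1 / g\<close>, which may fail to be integrable at 0; hence a primitive
  on the open half-line with no value prescribed at 0.\<close>

lemma antiderivative_exists:
  fixes k :: "real \<Rightarrow> real"
  assumes "\<And>s. 0 < s \<Longrightarrow> isCont k s"
  obtains F where "\<And>s. 0 < s \<Longrightarrow> (F has_real_derivative k s) (at s)"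
proof -
  have "\<exists>F. \<forall>x. ereal 0 < ereal x \<longrightarrow> ereal x < \<infinity> \<longrightarrow> (F has_vector_derivative k x) (at x)"
    by (rule einterval_antiderivative) (use assms in auto)
  then show ?thesis
    using that by (auto simp: has_real_derivative_iff_has_vector_derivative)
qed

text \<open>Convergence at infinity bounds \<open>F\<close> above, and monotonicity gives
  \<open>F m \<le> F r\<close>. The cut-off \<open>m\<close> matters because \<open>F\<close> may
  tend to minus infinity at 0.\<close>

lemma antiderivative_bounded:
  fixes k F :: "real \<Rightarrow> real"
  assumes F: "\<And>s. 0 < s \<Longrightarrow> (F has_real_derivative k s) (at s)"
    and cont: "\<And>s. 0 < s \<Longrightarrow> isCont k s"
    and nonneg: "\<And>s. 0 < s \<Longrightarrow> 0 \<le> k s"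
    and "0 < a" and fin: "(\<integral>\<^sup>+ s\<in>{a..}. ennreal (k s) \<partial>lborel) < \<infinity>"
    and "0 < m"
  obtains M where "\<And>s r. m \<le> r \<Longrightarrow> 0 < s \<Longrightarrow> F s - F r \<le> M"
proof -
  define I where "I = enn2real (\<integral>\<^sup>+ s\<in>{a..}. ennreal (k s) \<partial>lborel)"
  have mono: "F r \<le> F s" if "0 < r" "r \<le> s" for r s
    by (rule DERIV_nonneg_imp_nondecreasing[OF that(2)]) (meson that F nonneg less_le_trans)
  have I: "0 \<le> I" by (simp add: I_def)
  have "F s \<le> F a + I" if "a \<le> s" for s
  proof -
    have "continuous_on {0<..} k"
      using cont by (simp add: continuous_on_eq_continuous_at)
    \<comment> \<open>Freezing \<open>k\<close> to the left of \<open>a\<close> gives a continuous,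
      hence Borel, function on the whole line that agrees with \<open>k\<close> on the range of
      integration.\<close>
    then have "continuous_on UNIV (\<lambda>x. k (max a x))"
      by (rule continuous_on_compose2) (use \<open>0 < a\<close> in \<open>auto intro!: continuous_intros\<close>)
    then have "ennreal (F s - F a) = (\<integral>\<^sup>+ x. ennreal (k (max a x)) * indicator {a..s} x \<partial>lborel)"
    proof (rule nn_integral_FTC_Icc[OF borel_measurable_continuous_onI, symmetric])
      fix x assume "x \<in> {a..s}"
      with \<open>0 < a\<close> F[of x] nonneg[of x]
      show "(F has_real_derivative k (max a x)) (at x)" "0 \<le> k (max a x)"
        by (simp_all add: max_absorb2)
    qed (use that in simp_all)
    also have "\<dots> = (\<integral>\<^sup>+ x. ennreal (k x) * indicator {a..s} x \<partial>lborel)"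
      by (rule nn_integral_cong) (auto simp: indicator_def)
    also have "\<dots> \<le> (\<integral>\<^sup>+ x\<in>{a..}. ennreal (k x) \<partial>lborel)"
      by (rule nn_integral_mono) (auto simp: indicator_def)
    also have "\<dots> = ennreal I"
      using fin by (simp add: I_def)
    finally have "ennreal (F s - F a) \<le> ennreal I" .
    then show ?thesis by (simp add: ennreal_le_iff[OF I])
  qed
  with I have ub: "F s \<le> F a + I" if "0 < s" for s
    using mono[OF that, of a] by (cases "a \<le> s") fastforce+
  show ?thesis
  proof (rule that[of "F a + I - F m"])
    fix s r :: real assume "m \<le> r" "0 < s"
    then show "F s - F r \<le> F a + I - F m"
      using ub[of s] mono[of m r] \<open>0 < m\<close> by simp
  qed
qed

text \<open>If the integrals from \<open>t0\<close> stayed bounded, the nondecreasing primitive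
  would converge at infinity and the integral from 0 would be finite.\<close>

lemma integral_unbounded_of_nn_integral_infinite:
  fixes b :: "real \<Rightarrow> real"
  assumes cont: "continuous_on {0..} b" and nonneg: "\<And>t. 0 \<le> t \<Longrightarrow> 0 \<le> b t"
    and inf: "(\<integral>\<^sup>+ t\<in>{0..}. ennreal (b t) \<partial>lborel) = \<infinity>"
    and "0 \<le> t0"
  obtains T where "t0 < T" "K < integral {t0..T} b"
proof -
  \<comment> \<open>Constant extension to negative times provides an antiderivative on the whole
    line.\<close>
  define c where "c t = b (max t 0)" for t
  have cc: "continuous_on UNIV c"
    unfolding c_def
    by (rule continuous_on_compose2[OF cont]) (auto intro!: continuous_intros)
  have c0: "0 \<le> c t" for t
    by (simp add: c_def nonneg)
  have "\<exists>F. \<forall>x. (-\<infinity>::ereal) < ereal x \<longrightarrow> ereal x < \<infinity> \<longrightarrow> (F has_vector_derivative c x) (at x)"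
    by (rule einterval_antiderivative) (use cc in \<open>auto simp: continuous_on_eq_continuous_at\<close>)
  then obtain F where F: "\<And>x. (F has_real_derivative c x) (at x)"
    by (auto simp: has_real_derivative_iff_has_vector_derivative)
  have monoF: "F x \<le> F y" if "x \<le> y" for x y
    by (rule DERIV_nonneg_imp_nondecreasing[OF that]) (use F c0 in blast)
  have "\<exists>T. t0 < T \<and> F t0 + K < F T"
  proof (rule ccontr)
    assume "\<not> ?thesis"
    then have le: "F T \<le> F t0 + K" if "t0 < T" for T
      using that by fastforce
    have bdd: "F x \<le> F t0 + K" for x
      using le[of "max x t0 + 1"] monoF[of x "max x t0 + 1"] by linarith
    have "incseq (\<lambda>n. F (real n))"
      by (auto simp: incseq_def intro: monoF)
    then obtain L where "(\<lambda>n. F (real n)) \<longlonglongrightarrow> L"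
      using incseq_convergent[of "\<lambda>n. F (real n)" "F t0 + K"] bdd by blast
    then have lim: "(F \<longlongrightarrow> L) at_top"
      by (intro tendsto_at_topI_sequentially_real) (auto simp: mono_def intro: monoF)
    from nn_integral_FTC_atLeast[of c 0 F, OF _ F c0 this]
    have "(\<integral>\<^sup>+t\<in>{0..}. ennreal (c t) \<partial>lborel) \<noteq> \<infinity>"
      using cc by (simp add: borel_measurable_continuous_onI)
    moreover have "(\<integral>\<^sup>+t\<in>{0..}. ennreal (c t) \<partial>lborel) = (\<integral>\<^sup>+ t\<in>{0..}. ennreal (b t) \<partial>lborel)"
      by (rule nn_integral_cong) (auto simp: c_def indicator_def)
    ultimately show False using inf by simp
  qed
  then obtain T where T: "t0 < T" "F t0 + K < F T" by blast
  have "(c has_integral F T - F t0) {t0..T}"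
    by (rule fundamental_theorem_of_calculus)
       (use T F in \<open>auto simp: has_real_derivative_iff_has_vector_derivative[symmetric] intro: DERIV_subset\<close>)
  then have "(b has_integral F T - F t0) {t0..T}"
    by (rule has_integral_eq[rotated]) (use \<open>0 \<le> t0\<close> in \<open>auto simp: c_def\<close>)
  with T that show ?thesis by (metis integral_unique add.commute less_diff_eq)
qed

section \<open>Neighbourhoods, slices and differentiation under the integral\<close>

lemma isCont_pos_nbhd:
  fixes f :: "real \<Rightarrow> real"
  assumes "isCont f 0" "0 < f 0"
  obtains e where "0 < e" "\<And>s. \<bar>s\<bar> < e \<Longrightarrow> 0 < f s"
proof -
  have "eventually (\<lambda>s. 0 < f s) (nhds 0)"
    using order_tendstoD(1)[OF assms(1)[unfolded isCont_def] assms(2)] assms(2)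
    by (simp add: eventually_nhds_conv_at)
  then show ?thesis
    using that by (auto simp: eventually_nhds_metric dist_real_def)
qed

lemma open_line_nbhd:
  fixes x h :: "'a::real_normed_vector"
  assumes "open S" "x \<in> S"
  obtains e where "0 < e" "\<And>s. \<bar>s\<bar> < e \<Longrightarrow> x + s *\<^sub>R h \<in> S"
proof -
  have "open ((\<lambda>s. x + s *\<^sub>R h) -` S)"
    by (intro open_vimage assms continuous_intros)
  moreover have "0 \<in> (\<lambda>s. x + s *\<^sub>R h) -` S" using assms by simp
  ultimately obtain e where "0 < e" "ball 0 e \<subseteq> (\<lambda>s. x + s *\<^sub>R h) -` S"
    by (meson open_contains_ball)
  then show ?thesis using that[of e] by (auto simp: subset_iff dist_real_def)
qed

lemma continuous_on_slice:
  assumes "continuous_on (A \<times> B) (\<lambda>(x, t). f x t)" "x \<in> A"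
  shows "continuous_on B (f x)"
proof -
  have "continuous_on B (\<lambda>t. case (x, t) of (x, t) \<Rightarrow> f x t)"
    by (rule continuous_on_compose2[OF assms(1)])
       (use assms(2) in \<open>auto intro!: continuous_intros\<close>)
  then show ?thesis by simp
qed

text \<open>A convex \<open>U\<close> covers both an open interval about 0 and a closed interval
  starting at 0, where the derivative is one-sided.\<close>

lemma leibniz_rule_real:
  fixes f f' :: "real \<Rightarrow> real \<Rightarrow> real"
  assumes "\<And>s t. s \<in> U \<Longrightarrow> t \<in> {a..b} \<Longrightarrow> ((\<lambda>s. f s t) has_real_derivative f' s t) (at s within U)"
    and "\<And>s. s \<in> U \<Longrightarrow> continuous_on {a..b} (f s)"
    and "continuous_on (U \<times> {a..b}) (\<lambda>(s, t). f' s t)"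
    and "s0 \<in> U" "convex U"
  shows "((\<lambda>s. integral {a..b} (f s)) has_real_derivative integral {a..b} (f' s0)) (at s0 within U)"
  using leibniz_rule_field_derivative[where U = U and a = a and b = b and f = f and fx = f'] assms
  by (simp add: integrable_continuous_real)

section \<open>Geometry of the boundary\<close>

text \<open>Differentiability is relative to \<open>S\<close> and the parameter to \<open>I\<close>,
  so that a segment entering the closure from a boundary point is covered.\<close>

lemma has_real_derivative_along_line:
  fixes f :: "'a::real_normed_vector \<Rightarrow> real"
  assumes "(f has_derivative f') (at (x + s *\<^sub>R h) within S)"
    and "\<And>r. r \<in> I \<Longrightarrow> x + r *\<^sub>R h \<in> S"
  shows "((\<lambda>s. f (x + s *\<^sub>R h)) has_real_derivative f' h) (at s within I)"
proof -
  have line: "((\<lambda>r. x + r *\<^sub>R h) has_derivative (\<lambda>r. r *\<^sub>R h)) (at s within I)"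
    by (auto intro!: derivative_eq_intros)
  have "((\<lambda>s. f (x + s *\<^sub>R h)) has_derivative (\<lambda>r. f' (r *\<^sub>R h))) (at s within I)"
    by (rule has_derivative_in_compose[OF line has_derivative_subset[OF assms(1)]])
       (use assms(2) in auto)
  moreover have "f' (r *\<^sub>R h) = f' h * r" for r
    using linear_cmul[OF has_derivative_linear[OF assms(1)], of r h] by simp
  ultimately show ?thesis by (simp add: has_field_derivative_def)
qed

lemma boundary_chart_exists:
  assumes "bounded_smooth_domain \<Omega>" "p \<in> frontier \<Omega>"
  obtains r e \<gamma> where "boundary_chart \<Omega> p r e \<gamma>" "open \<Omega>"
proof -
  have "open \<Omega>" "\<exists>r e \<gamma>. boundary_chart \<Omega> p r e \<gamma>"
    using assms by (simp_all add: bounded_smooth_domain_def smooth_boundary_def)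
  with that show ?thesis by meson
qed

text \<open>The chart at \<open>p\<close>, shrunk to radius \<open>r - dist p x\<close>, is a chart
  at \<open>x\<close> with the same \<open>e\<close> and \<open>\<gamma>\<close>, and the normal
  does not depend on the chart.\<close>

lemma unit_exterior_normal_ball:
  assumes "open \<Omega>" "boundary_chart \<Omega> p r e \<gamma>" "x \<in> frontier \<Omega>" "x \<in> ball p r"
  shows "unit_exterior_normal \<Omega> x = sgn (e - gradient \<gamma> x)" and "x \<bullet> e = \<gamma> x"
    and "e - gradient \<gamma> x \<noteq> 0"
proof -
  have "ball x (r - dist p x) \<subseteq> ball p r"
  proof
    fix z assume "z \<in> ball x (r - dist p x)"
    then show "z \<in> ball p r" using dist_triangle[of p z x] by simp
  qed
  then have "boundary_chart \<Omega> x (r - dist p x) e \<gamma>"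
    using assms(2,4) unfolding boundary_chart_def by (simp add: set_eq_iff subset_iff) blast
  from unit_exterior_normal_eq[OF assms(1,3) this] boundary_chart_derivative[OF assms(1,3) this]
  show "unit_exterior_normal \<Omega> x = sgn (e - gradient \<gamma> x)" "x \<bullet> e = \<gamma> x"
    "e - gradient \<gamma> x \<noteq> 0"
    by (auto simp: chart_normal_def)
qed

lemma norm_unit_exterior_normal:
  assumes "bounded_smooth_domain \<Omega>" "x \<in> frontier \<Omega>"
  shows "norm (unit_exterior_normal \<Omega> x) = 1"
proof -
  obtain r e \<gamma> where ch: "boundary_chart \<Omega> x r e \<gamma>" and op: "open \<Omega>"
    by (rule boundary_chart_exists[OF assms])
  then have "x \<in> ball x r" by (simp add: boundary_chart_def)
  with unit_exterior_normal_ball[OF op ch assms(2)] show ?thesis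
    by (simp add: norm_sgn)
qed

text \<open>In a chart, \<open>x \<bullet> e - \<gamma> x\<close> vanishes at \<open>p\<close> and
  has derivative \<open>- norm N\<close> along the inward normal, so it is negative just behind
  \<open>p\<close>, which means membership in \<open>\<Omega>\<close>.\<close>

lemma inward_segment:
  assumes "bounded_smooth_domain \<Omega>" "p \<in> frontier \<Omega>"
  obtains d where "0 < d" "\<And>s. 0 < s \<Longrightarrow> s \<le> d \<Longrightarrow> p - s *\<^sub>R unit_exterior_normal \<Omega> p \<in> \<Omega>"
proof -
  define \<nu> where "\<nu> = unit_exterior_normal \<Omega> p"
  obtain r e \<gamma> where ch: "boundary_chart \<Omega> p r e \<gamma>" and op: "open \<Omega>"
    by (rule boundary_chart_exists[OF assms])
  have r: "0 < r" and eq: "\<Omega> \<inter> ball p r = {x \<in> ball p r. x \<bullet> e < \<gamma> x}"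
    using ch by (auto simp: boundary_chart_def)
  note D = boundary_chart_derivative[OF op assms(2) ch]
  define N where "N = e - gradient \<gamma> p"
  have \<nu>: "\<nu> = sgn N" "norm \<nu> = 1"
    using unit_exterior_normal_ball[OF op ch assms(2)] r norm_unit_exterior_normal[OF assms]
    by (auto simp: \<nu>_def N_def)
  have "((\<lambda>s. (p + s *\<^sub>R - \<nu>) \<bullet> e - \<gamma> (p + s *\<^sub>R - \<nu>)) has_real_derivative - \<nu> \<bullet> N) (at 0)"
    by (rule has_real_derivative_along_line[where S = UNIV]) (use D(1) in \<open>auto simp: N_def\<close>)
  moreover have "\<nu> \<bullet> N = norm N"
    using D(3)
    by (simp add: \<nu> N_def[symmetric] sgn_div_norm power2_norm_eq_inner[symmetric] power2_eq_square)
  ultimately have "((\<lambda>s. (p - s *\<^sub>R \<nu>) \<bullet> e - \<gamma> (p - s *\<^sub>R \<nu>)) has_real_derivative - norm N) (at 0)"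
    by simp
  moreover have "- norm N < 0" using D(3) by (simp add: N_def)
  ultimately obtain d where "0 < d"
    and d: "\<And>s. 0 < s \<Longrightarrow> s < d \<Longrightarrow> (p - s *\<^sub>R \<nu>) \<bullet> e - \<gamma> (p - s *\<^sub>R \<nu>) < 0"
    using DERIV_neg_dec_right[of "\<lambda>s. (p - s *\<^sub>R \<nu>) \<bullet> e - \<gamma> (p - s *\<^sub>R \<nu>)" "- norm N" 0] D(2)
    by auto
  show ?thesis
  proof (rule that[of "min d r / 2"])
    show "0 < min d r / 2" using \<open>0 < d\<close> r by simp
    fix s assume s: "0 < s" "s \<le> min d r / 2"
    then have "s < d" "s < r" using \<open>0 < d\<close> r by auto
    then have "p - s *\<^sub>R \<nu> \<in> ball p r" using \<nu>(2) s by (simp add: dist_norm)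
    then have "p - s *\<^sub>R \<nu> \<in> {x \<in> ball p r. x \<bullet> e < \<gamma> x}"
      using d[OF s(1) \<open>s < d\<close>] by simp
    then show "p - s *\<^sub>R unit_exterior_normal \<Omega> p \<in> \<Omega>"
      unfolding eq[symmetric] \<nu>_def by blast
  qed
qed

lemma has_derivative_gradient:
  assumes "\<gamma> differentiable at x"
  shows "(\<gamma> has_derivative (\<lambda>h. h \<bullet> gradient \<gamma> x)) (at x)"
proof -
  let ?D = "frechet_derivative \<gamma> (at x)"
  have D: "(\<gamma> has_derivative ?D) (at x)"
    using assms by (simp add: frechet_derivative_works)
  have lin: "linear ?D" by (rule has_derivative_linear[OF D])
  have "?D h = h \<bullet> gradient \<gamma> x" for h
  proof -
    have "?D h = ?D (\<Sum>b\<in>Basis. (h \<bullet> b) *\<^sub>R b)" by (simp add: euclidean_representation)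
    also have "\<dots> = (\<Sum>b\<in>Basis. (h \<bullet> b) * ?D b)"
      by (simp add: linear_sum[OF lin] linear_cmul[OF lin])
    also have "\<dots> = h \<bullet> gradient \<gamma> x"
      by (simp add: gradient_def inner_sum_right mult.commute)
    finally show ?thesis .
  qed
  then have "?D = (\<lambda>h. h \<bullet> gradient \<gamma> x)" by (rule ext)
  with D show ?thesis by simp
qed

text \<open>Seen from a point slightly below \<open>p\<close> in the chart direction, the piece of the boundary
  near \<open>p\<close> is strictly star-shaped. Continuity of the normal suffices because the
  chart direction is orthogonal to the gradient of \<open>\<gamma>\<close>.\<close>

lemma boundary_locally_star_shaped:
  assumes "bounded_smooth_domain \<Omega>" "p \<in> frontier \<Omega>"
  obtains y \<delta> where "0 < \<delta>" "y \<in> \<Omega>" "p \<in> ball y \<delta>"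
    "\<And>x. x \<in> frontier \<Omega> \<Longrightarrow> x \<in> ball y \<delta> \<Longrightarrow> 0 < (x - y) \<bullet> unit_exterior_normal \<Omega> x"
proof -
  obtain r e \<gamma> where ch: "boundary_chart \<Omega> p r e \<gamma>" and op: "open \<Omega>"
    by (rule boundary_chart_exists[OF assms])
  have r: "0 < r" and eq: "\<Omega> \<inter> ball p r = {x \<in> ball p r. x \<bullet> e < \<gamma> x}"
    and e: "norm e = 1" and inv: "\<And>x s. \<gamma> (x + s *\<^sub>R e) = \<gamma> x" and "smooth \<gamma>"
    using ch by (auto simp: boundary_chart_def)
  from \<open>smooth \<gamma>\<close> have "Ck (Suc 0) \<gamma>" unfolding smooth_def by blast
  then have dif: "\<And>x. \<gamma> differentiable at x"
    and cb: "\<And>b. b \<in> Basis \<Longrightarrow> continuous_on UNIV (\<lambda>x. frechet_derivative \<gamma> (at x) b)"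
    by auto
  define G where "G = gradient \<gamma>"
  have D: "(\<gamma> has_derivative (\<lambda>h. h \<bullet> G x)) (at x)" for x
    unfolding G_def by (rule has_derivative_gradient[OF dif])
  have "continuous_on UNIV G"
    unfolding G_def gradient_def by (intro continuous_intros cb)
  then have "isCont G p" by (simp add: continuous_on_eq_continuous_at)
  \<comment> \<open>Two deviations below 1/6 give \<open>dist (G z) (G x) < 1/3\<close>; as
    \<open>x\<close> is within \<open>3 * \<delta>\<close> of \<open>p\<close>, the resulting error
    stays below \<open>\<delta>\<close>.\<close>
  then have "\<exists>\<eta>>0. \<forall>x. dist x p < \<eta> \<longrightarrow> dist (G x) (G p) < 1/6"
    unfolding continuous_at_eps_delta by (elim allE[of _ "1/6"]) simp
  then obtain \<eta> where "0 < \<eta>" and \<eta>: "\<And>x. dist x p < \<eta> \<Longrightarrow> dist (G x) (G p) < 1/6"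
    by blast
  have Ge: "e \<bullet> G x = 0" for x
  proof -
    have "((\<lambda>s. \<gamma> (x + s *\<^sub>R e)) has_real_derivative e \<bullet> G x) (at 0)"
      by (rule has_real_derivative_along_line[where S = UNIV]) (use D[of x] in auto)
    then have "((\<lambda>s. \<gamma> x) has_real_derivative e \<bullet> G x) (at 0)" by (simp add: inv)
    then show ?thesis by (rule DERIV_unique) simp
  qed
  \<comment> \<open>The ball of radius \<open>2 * \<delta>\<close> about \<open>y\<close> lies
    within \<open>3 * \<delta>\<close> of \<open>p\<close>, hence inside both the chart and the
    \<open>\<eta>\<close>-ball.\<close>
  define \<delta> where "\<delta> = min \<eta> r / 4"
  have \<delta>: "0 < \<delta>" "3 * \<delta> < \<eta>" "3 * \<delta> < r"
    using \<open>0 < \<eta>\<close> r by (auto simp: \<delta>_def)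
  define y where "y = p - \<delta> *\<^sub>R e"
  have dpy: "dist p y = \<delta>" using e \<delta> by (simp add: y_def dist_norm)
  have pr: "p \<in> ball p r" using r by simp
  have "\<gamma> y = \<gamma> p" using inv[of p "- \<delta>"] by (simp add: y_def)
  moreover have "y \<bullet> e = p \<bullet> e - \<delta>"
    using e by (simp add: y_def inner_diff_left norm_eq_1)
  ultimately have "y \<bullet> e < \<gamma> y"
    using unit_exterior_normal_ball(2)[OF op ch assms(2) pr] \<delta> by simp
  moreover have "y \<in> ball p r" using dpy \<delta> by simp
  ultimately have "y \<in> \<Omega>" using eq by blast
  show ?thesis
  proof (rule that[of "2 * \<delta>" y])
    show "0 < 2 * \<delta>" using \<delta> by simp
    show "y \<in> \<Omega>" by fact
    show "p \<in> ball y (2 * \<delta>)" using dpy \<delta> by (simp add: dist_commute)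
    fix x assume x: "x \<in> frontier \<Omega>" "x \<in> ball y (2 * \<delta>)"
    have dpx: "dist p x < 3 * \<delta>"
      using dist_triangle[of p x y] x(2) dpy by simp
    then have xr: "x \<in> ball p r" using \<delta> by simp
    note X = unit_exterior_normal_ball[OF op ch x(1) xr]
    have "\<exists>z\<in>closed_segment p x. \<gamma> x - \<gamma> p = (x - p) \<bullet> G z"
    proof -
      have "((\<lambda>s. \<gamma> (p + s *\<^sub>R (x - p))) has_real_derivative (x - p) \<bullet> G (p + s *\<^sub>R (x - p))) (at s)" for s
        by (rule has_real_derivative_along_line[where S = UNIV]) (use D in auto)
      from MVT2[of 0 1 "\<lambda>s. \<gamma> (p + s *\<^sub>R (x - p))", OF _ this]
      obtain z where z: "0 < z" "z < 1" "\<gamma> x - \<gamma> p = (x - p) \<bullet> G (p + z *\<^sub>R (x - p))" by auto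
      moreover have "p + z *\<^sub>R (x - p) \<in> closed_segment p x"
        using z(1,2) unfolding in_segment by (intro exI[of _ z]) (auto simp: algebra_simps)
      ultimately show ?thesis by blast
    qed
    then obtain z where z: "z \<in> closed_segment p x" "\<gamma> x - \<gamma> p = (x - p) \<bullet> G z" by blast
    have "dist z p < \<eta>" "dist x p < \<eta>"
      using dpx \<delta> segment_bound(1)[OF z(1)] by (auto simp: dist_norm norm_minus_commute)
    then have "dist (G z) (G x) < 1/3"
      using \<eta>[of z] \<eta>[of x] dist_triangle2[of "G z" "G x" "G p"] by simp
    then have "\<bar>(x - p) \<bullet> (G z - G x)\<bar> \<le> norm (x - p) * (1/3)"
      by (intro order_trans[OF Cauchy_Schwarz_ineq2] mult_left_mono) (auto simp: dist_norm)
    then have small: "\<bar>(x - p) \<bullet> (G z - G x)\<bar> < \<delta>"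
      using dpx by (simp add: dist_norm norm_minus_commute)
    \<comment> \<open>Write \<open>x - y\<close> as \<open>(x - p) + \<delta> *\<^sub>R e\<close>.
      The graph equation turns \<open>(x - p) \<bullet> e\<close> into
      \<open>\<gamma> x - \<gamma> p\<close>, and orthogonality of \<open>e\<close> and
      \<open>G x\<close> leaves the full gain \<open>\<delta>\<close>.\<close>
    have "(x - y) \<bullet> (e - G x) = (x - p) \<bullet> (G z - G x) + \<delta>"
      using z(2) X(2) unit_exterior_normal_ball(2)[OF op ch assms(2) pr] Ge[of x] e
      by (simp add: y_def inner_diff_left inner_diff_right inner_add_left inner_add_right norm_eq_1)
    then have "0 < (x - y) \<bullet> (e - G x)" using small by simp
    moreover have "0 < norm (e - G x)" using X(3) by (simp add: G_def)
    ultimately show "0 < (x - y) \<bullet> unit_exterior_normal \<Omega> x"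
      unfolding X(1) sgn_div_norm G_def[symmetric] inner_scaleR_right by simp
  qed
qed

section \<open>Supersolutions of the heat equation with nonnegative flux\<close>

text \<open>For positivity, source and flux matter only through their signs, so the equation enters
  as an inequality. The flux bound later adds the exact boundary condition as an assumption.\<close>

locale neumann_supersolution =
  fixes \<Omega> :: "'a::euclidean_space set" and u :: "'a \<Rightarrow> real \<Rightarrow> real"
  assumes domain: "bounded_smooth_domain \<Omega>"
    and C21: "\<And>T. 0 < T \<Longrightarrow> C21 \<Omega> T u"
    and C10: "\<And>T. 0 < T \<Longrightarrow> C10 \<Omega> T u"
    and nonneg: "\<And>x t. x \<in> closure \<Omega> \<Longrightarrow> 0 \<le> t \<Longrightarrow> 0 \<le> u x t"
    and super: "\<And>x t. x \<in> \<Omega> \<Longrightarrow> 0 < t \<Longrightarrow> laplacian u x t \<le> dt u x t"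
    and flux: "\<And>x t. x \<in> frontier \<Omega> \<Longrightarrow> 0 < t \<Longrightarrow> 0 \<le> normal_derivative \<Omega> (\<lambda>y. u y t) x"
begin

section \<open>Regularity up to the boundary and along lines\<close>

lemma open_domain: "open \<Omega>" and connected_domain: "connected \<Omega>"
  and compact_closure_domain: "compact (closure \<Omega>)"
  using domain by (auto simp: bounded_smooth_domain_def)

lemma in_closure: "x \<in> closure \<Omega> \<longleftrightarrow> x \<in> \<Omega> \<or> x \<in> frontier \<Omega>"
  using closure_Un_frontier[of \<Omega>] by blast

lemma cylinder_Un_parabolic_boundary:
  assumes "0 < T"
  shows "cylinder \<Omega> T \<union> parabolic_boundary \<Omega> T = closure \<Omega> \<times> {0..<T}"
  using assms unfolding cylinder_def parabolic_boundary_def lateral_boundary_def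
  by (auto simp: in_closure less_le)

text \<open>Taken relative to the closure, it makes sense at boundary points, where its value at the
  exterior normal is \<open>normal_derivative\<close>.\<close>

abbreviation gradient_form :: "'a \<Rightarrow> real \<Rightarrow> 'a \<Rightarrow> real" where
  "gradient_form x t \<equiv> frechet_derivative (\<lambda>y. u y t) (at x within closure \<Omega>)"

lemma has_derivative_closure:
  assumes "x \<in> closure \<Omega>" "0 \<le> t"
  shows "((\<lambda>y. u y t) has_derivative gradient_form x t) (at x within closure \<Omega>)"
proof -
  have "0 < t + 1" using assms by simp
  from C10[OF this] have "(\<lambda>y. u y t) differentiable (at x within closure \<Omega>)"
    unfolding C10_def cylinder_Un_parabolic_boundary[OF \<open>0 < t + 1\<close>] using assms by auto
  then show ?thesis by (simp add: frechet_derivative_works)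
qed

lemma continuous_u:
  assumes "0 \<le> a"
  shows "continuous_on (closure \<Omega> \<times> {a..b}) (\<lambda>(x, t). u x t)"
proof -
  \<comment> \<open>The horizon must be positive and exceed \<open>b\<close>, whatever the sign of
    \<open>b\<close>.\<close>
  have T: "0 < max 1 (b + 1)" by simp
  show ?thesis
    using C10[OF T] assms unfolding C10_def cylinder_Un_parabolic_boundary[OF T]
    by (auto elim!: continuous_on_subset)
qed

text \<open>\<open>C10\<close> gives continuity for basis directions; linearity extends it to any
  fixed \<open>v\<close>, in particular to the inward normal at a given boundary point.\<close>

lemma continuous_gradient_form:
  assumes "0 \<le> a"
  shows "continuous_on (closure \<Omega> \<times> {a..b}) (\<lambda>(x, t). gradient_form x t v)"
proof -
  have T: "0 < max 1 (b + 1)" by simp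
  have *: "continuous_on (closure \<Omega> \<times> {a..b}) (\<lambda>(x, t). gradient_form x t i)"
    if "i \<in> Basis" for i
  proof (rule continuous_on_subset)
    show "continuous_on (closure \<Omega> \<times> {0..<max 1 (b + 1)}) (\<lambda>(x, t). gradient_form x t i)"
      using C10[OF T] that unfolding C10_def cylinder_Un_parabolic_boundary[OF T] by blast
  qed (use assms in auto)
  have "continuous_on (closure \<Omega> \<times> {a..b})
      (\<lambda>p. \<Sum>i\<in>Basis. (v \<bullet> i) * (case p of (x, t) \<Rightarrow> gradient_form x t i))"
    by (intro continuous_intros *)
  then show ?thesis
  proof (rule continuous_on_eq)
    fix p assume p: "p \<in> closure \<Omega> \<times> {a..b}"
    obtain x t where xt: "p = (x, t)" "x \<in> closure \<Omega>" "0 \<le> t"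
      using p assms by (cases p) auto
    have lin: "linear (gradient_form x t)"
      by (rule has_derivative_linear[OF has_derivative_closure[OF xt(2,3)]])
    have "gradient_form x t v = gradient_form x t (\<Sum>i\<in>Basis. (v \<bullet> i) *\<^sub>R i)"
      by (simp add: euclidean_representation)
    also have "\<dots> = (\<Sum>i\<in>Basis. (v \<bullet> i) * gradient_form x t i)"
      by (simp add: linear_sum[OF lin] linear_cmul[OF lin])
    finally show "(\<Sum>i\<in>Basis. (v \<bullet> i) * (case p of (x, t) \<Rightarrow> gradient_form x t i)) =
        (case p of (x, t) \<Rightarrow> gradient_form x t v)"
      by (simp add: xt(1))
  qed
qed

lemma
  assumes "x \<in> \<Omega>" "0 < t"
  shows has_time_derivative: "((\<lambda>s. u x s) has_real_derivative dt u x t) (at t)"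
    and has_space_derivative:
      "((\<lambda>y. u y t) has_derivative frechet_derivative (\<lambda>y. u y t) (at x)) (at x)"
    and has_second_space_derivative:
      "b \<in> Basis \<Longrightarrow>
        ((\<lambda>y. dx b u y t) has_derivative frechet_derivative (\<lambda>y. dx b u y t) (at x)) (at x)"
proof -
  have T: "0 < t + 1" using assms by simp
  have mem: "(x, t) \<in> cylinder \<Omega> (t + 1)" using assms by (simp add: cylinder_def)
  with C21[OF T] have "(\<lambda>s. u x s) differentiable at t" "(\<lambda>y. u y t) differentiable at x"
    "b \<in> Basis \<Longrightarrow> (\<lambda>y. dx b u y t) differentiable at x"
    unfolding C21_def by blast+
  then show "((\<lambda>s. u x s) has_real_derivative dt u x t) (at t)"
    "((\<lambda>y. u y t) has_derivative frechet_derivative (\<lambda>y. u y t) (at x)) (at x)"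
    "b \<in> Basis \<Longrightarrow>
        ((\<lambda>y. dx b u y t) has_derivative frechet_derivative (\<lambda>y. dx b u y t) (at x)) (at x)"
    by (simp_all add: DERIV_deriv_iff_real_differentiable frechet_derivative_works)
qed

lemma
  assumes "0 < t" "x + s *\<^sub>R b \<in> \<Omega>" "b \<in> Basis"
  shows has_line_derivative:
      "((\<lambda>s. u (x + s *\<^sub>R b) t) has_real_derivative dx b u (x + s *\<^sub>R b) t) (at s)"
    and has_second_line_derivative:
      "((\<lambda>s. dx b u (x + s *\<^sub>R b) t) has_real_derivative dx b (dx b u) (x + s *\<^sub>R b) t) (at s)"
  unfolding dx_def[of b u "x + s *\<^sub>R b"] dx_def[of b "dx b u" "x + s *\<^sub>R b"]
  by (rule has_real_derivative_along_line[where S = UNIV];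
      use has_space_derivative[OF assms(2,1)] has_second_space_derivative[OF assms(2,1,3)] in simp)+

lemma
  assumes "0 < a"
  shows continuous_time_derivative: "continuous_on (\<Omega> \<times> {a..b}) (\<lambda>(x, t). dt u x t)"
    and continuous_space_derivative:
      "i \<in> Basis \<Longrightarrow> continuous_on (\<Omega> \<times> {a..b}) (\<lambda>(x, t). dx i u x t)"
    and continuous_second_space_derivative:
      "i \<in> Basis \<Longrightarrow> continuous_on (\<Omega> \<times> {a..b}) (\<lambda>(x, t). dx i (dx i u) x t)"
proof -
  have T: "0 < max 1 (b + 1)" by simp
  have sub: "\<Omega> \<times> {a..b} \<subseteq> cylinder \<Omega> (max 1 (b + 1))"
    using assms by (auto simp: cylinder_def)
  show "continuous_on (\<Omega> \<times> {a..b}) (\<lambda>(x, t). dt u x t)"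
    by (rule continuous_on_subset[OF _ sub]) (use C21[OF T] in \<open>simp add: C21_def\<close>)
  show "continuous_on (\<Omega> \<times> {a..b}) (\<lambda>(x, t). dx i u x t)" if "i \<in> Basis"
    by (rule continuous_on_subset[OF _ sub]) (use C21[OF T] that in \<open>simp add: C21_def\<close>)
  show "continuous_on (\<Omega> \<times> {a..b}) (\<lambda>(x, t). dx i (dx i u) x t)" if "i \<in> Basis"
    by (rule continuous_on_subset[OF _ sub]) (use C21[OF T] that in \<open>simp add: C21_def\<close>)
qed

section \<open>A lower barrier in balls\<close>

text \<open>Comparison with the explicit subsolution \<open>c e\<^bsup>-\<mu>(s-t1)\<^esup> q\<^sup>2\<close>,
  where \<open>q(x,s) = h(s) - |x-y|\<^sup>2\<close> and \<open>h\<close> grows linearly from \<open>\<rho>\<^sup>2\<close> to \<open>R\<^sup>2\<close>.\<close>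

lemma positivity_spreads:
  assumes \<rho>: "0 < \<rho>" "\<rho> < R" "cball y \<rho> \<subseteq> \<Omega>" and t: "0 < t1" "t1 < t2"
    and star: "\<And>x. x \<in> frontier \<Omega> \<Longrightarrow> x \<in> ball y R \<Longrightarrow> 0 < (x - y) \<bullet> unit_exterior_normal \<Omega> x"
    and pos: "\<And>x. x \<in> cball y \<rho> \<Longrightarrow> 0 < u x t1"
    and z: "z \<in> closure \<Omega>" "z \<in> ball y R"
  shows "0 < u z t2"
proof -
  define \<kappa> where "\<kappa> = (R\<^sup>2 - \<rho>\<^sup>2) / (t2 - t1)"
  define h where "h s = \<rho>\<^sup>2 + \<kappa> * (s - t1)" for s
  \<comment> \<open>\<open>A\<close> collects the terms linear in \<open>Q\<close> at an interior
    minimum, and \<open>\<mu>\<close> makes the discriminant of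
    \<open>\<mu> * Q\<^sup>2 - A * Q + 8 * \<rho>\<^sup>2\<close> equal to
    \<open>- A\<^sup>2\<close>.\<close>
  define A where "A = 2 * \<kappa> + 8 + 4 * real DIM('a)"
  define \<mu> where "\<mu> = A\<^sup>2 / (16 * \<rho>\<^sup>2)"
  have "\<rho>\<^sup>2 < R\<^sup>2" using \<rho> by (intro power_strict_mono) auto
  then have \<kappa>: "0 < \<kappa>" using t by (simp add: \<kappa>_def)
  have A: "0 < A" using \<kappa> by (simp add: A_def add_pos_nonneg)
  have h_le: "\<rho>\<^sup>2 \<le> h s" if "t1 \<le> s" for s using that \<kappa> by (simp add: h_def)
  have h_mono: "h s \<le> R\<^sup>2" if "s \<le> t2" for s
  proof -
    have "\<kappa> * (s - t1) \<le> \<kappa> * (t2 - t1)" using that \<kappa> by simp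
    also have "\<dots> = R\<^sup>2 - \<rho>\<^sup>2" using t by (simp add: \<kappa>_def)
    finally show ?thesis by (simp add: h_def)
  qed
  have h2: "h t2 = R\<^sup>2" using t by (simp add: h_def \<kappa>_def)
  have cont_u1: "continuous_on (cball y \<rho>) (\<lambda>x. u x t1)"
    using \<rho>(3) closure_subset[of \<Omega>] t
    by (intro continuous_on_compose2[OF continuous_u[of 0 t1], where f = "\<lambda>x. (x, t1)", simplified])
       (auto intro!: continuous_intros)
  obtain x1 where x1: "x1 \<in> cball y \<rho>" "\<And>x. x \<in> cball y \<rho> \<Longrightarrow> u x1 t1 \<le> u x t1"
    using continuous_attains_inf[OF compact_cball _ cont_u1] \<rho> by auto
  \<comment> \<open>Since \<open>q \<le> \<rho>\<^sup>2\<close> at time \<open>t1\<close>, this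
    factor keeps the barrier below the minimum of \<open>u\<close> on the small ball.\<close>
  define c where "c = u x1 t1 / (\<rho>\<^sup>2)\<^sup>2"
  have c: "0 < c" using pos[OF x1(1)] \<rho> by (simp add: c_def)
  define q where "q x s = h s - (x - y) \<bullet> (x - y)" for x s
  define E where "E s = c * exp (- \<mu> * (s - t1))" for s
  define w where "w x s = E s * (q x s)\<^sup>2" for x s
  have E: "0 < E s" for s using c by (simp add: E_def)
  have inner_dist: "(x - y) \<bullet> (x - y) = (dist y x)\<^sup>2" for x
    by (simp add: dist_norm norm_minus_commute power2_norm_eq_inner)
  define K where "K = (closure \<Omega> \<times> {t1..t2}) \<inter> {p. 0 \<le> q (fst p) (snd p)}"
  have "compact K"
    unfolding K_def q_def h_def
    by (intro compact_Int_closed compact_Times compact_closure_domain compact_Icc closed_Collect_le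
        continuous_intros)
  have K_ball: "x \<in> ball y R" if "(x, s) \<in> K" "0 < q x s" for x s
  proof -
    have "(dist y x)\<^sup>2 < R\<^sup>2"
      using that h_mono[of s] by (auto simp: K_def q_def inner_dist)
    then have "dist y x < R" by (rule power2_less_imp_less) (use \<rho> in simp)
    then show ?thesis by simp
  qed
  have contK: "continuous_on K (\<lambda>(x, s). u x s - w x s)"
  proof -
    have "continuous_on K (\<lambda>(x, s). u x s)"
      by (rule continuous_on_subset[OF continuous_u[of t1 t2]]) (use t in \<open>auto simp: K_def\<close>)
    then show ?thesis
      unfolding w_def E_def q_def h_def case_prod_unfold by (intro continuous_intros)
  qed
  have compare: "w x s \<le> u x s" if xs: "(x, s) \<in> K" for x s
  proof (rule ccontr)
    assume neg: "\<not> w x s \<le> u x s"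
    obtain m where m: "m \<in> K" "\<And>p. p \<in> K \<Longrightarrow> (\<lambda>(x, s). u x s - w x s) m \<le> (\<lambda>(x, s). u x s - w x s) p"
      using continuous_attains_inf[OF \<open>compact K\<close> _ contK] xs by blast
    obtain x0 s0 where m_eq: "m = (x0, s0)" by (cases m)
    have x0: "x0 \<in> closure \<Omega>" "t1 \<le> s0" "s0 \<le> t2" "0 \<le> q x0 s0"
      using m(1) by (auto simp: m_eq K_def)
    have min: "u x0 s0 - w x0 s0 \<le> u x' s' - w x' s'"
      if "x' \<in> closure \<Omega>" "t1 \<le> s'" "s' \<le> t2" "0 \<le> q x' s'" for x' s'
      using m(2)[of "(x', s')"] that by (auto simp: m_eq K_def)
    have v0: "u x0 s0 < w x0 s0"
      using m(2)[OF xs] neg by (simp add: m_eq)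
    have "0 \<le> u x0 s0" using nonneg x0 t by simp
    \<comment> \<open>Where \<open>q = 0\<close> the barrier vanishes and \<open>u\<close> is
      nonnegative, so a negative minimum forces \<open>q > 0\<close>.\<close>
    with v0 have "q x0 s0 \<noteq> 0" by (auto simp: w_def)
    then have q0: "0 < q x0 s0" using x0 by simp
    have "s0 \<noteq> t1"
    proof
      assume s0: "s0 = t1"
      have "(dist y x0)\<^sup>2 \<le> \<rho>\<^sup>2" using q0 by (simp add: q_def h_def s0 inner_dist)
      then have "dist y x0 \<le> \<rho>" by (rule power2_le_imp_le) (use \<rho> in simp)
      then have "x0 \<in> cball y \<rho>" by simp
      then have "u x1 t1 \<le> u x0 t1" by (rule x1(2))
      moreover have "q x0 t1 \<le> \<rho>\<^sup>2" by (simp add: q_def h_def)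
      then have "(q x0 t1)\<^sup>2 \<le> (\<rho>\<^sup>2)\<^sup>2" using q0 by (intro power_mono) (auto simp: s0)
      then have "w x0 t1 \<le> c * (\<rho>\<^sup>2)\<^sup>2" using c by (simp add: w_def E_def)
      then have "w x0 t1 \<le> u x1 t1" using \<rho> by (simp add: c_def)
      ultimately show False using v0 by (simp add: s0)
    qed
    then have s0: "t1 < s0" "0 < s0" using x0 t by auto
    show False
    proof (cases "x0 \<in> \<Omega>")
      case False
      then have fr: "x0 \<in> frontier \<Omega>" using x0(1) in_closure by blast
      define \<nu> where "\<nu> = unit_exterior_normal \<Omega> x0"
      have out: "0 < (x0 - y) \<bullet> \<nu>"
        unfolding \<nu>_def by (rule star[OF fr K_ball[of x0 s0]]) (use m m_eq q0 in auto)
      obtain d where d: "0 < d" "\<And>s. 0 < s \<Longrightarrow> s \<le> d \<Longrightarrow> x0 - s *\<^sub>R \<nu> \<in> \<Omega>"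
        using inward_segment[OF domain fr] unfolding \<nu>_def by blast
      have "isCont (\<lambda>r. q (x0 + r *\<^sub>R - \<nu>) s0) 0"
        unfolding q_def by (intro continuous_intros)
      then obtain e where e: "0 < e" "\<And>r. \<bar>r\<bar> < e \<Longrightarrow> 0 < q (x0 + r *\<^sub>R - \<nu>) s0"
        by (rule isCont_pos_nbhd) (use q0 in auto)
      define d' where "d' = min d e / 2"
      have d': "0 < d'" "d' \<le> d" "d' < e" using d e by (auto simp: d'_def)
      have cl: "x0 + r *\<^sub>R - \<nu> \<in> closure \<Omega>" if "r \<in> {0..d'}" for r
        using d(2)[of r] d' that x0(1) closure_subset[of \<Omega>] by (cases "r = 0") auto
      have du: "((\<lambda>r. u (x0 + r *\<^sub>R - \<nu>) s0) has_real_derivative gradient_form x0 s0 (- \<nu>)) (at 0 within {0..d'})"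
        by (rule has_real_derivative_along_line[where S = "closure \<Omega>"])
           (use has_derivative_closure[OF x0(1), of s0] s0 cl in auto)
      have "gradient_form x0 s0 (- \<nu>) = - normal_derivative \<Omega> (\<lambda>y. u y s0) x0"
        using linear_neg[OF has_derivative_linear[OF has_derivative_closure[OF x0(1), of s0]]] s0
        by (simp add: normal_derivative_def \<nu>_def)
      with flux[OF fr s0(2)] have flux0: "gradient_form x0 s0 (- \<nu>) \<le> 0" by simp
      \<comment> \<open>Along the inward normal \<open>q\<close> grows at rate
        \<open>2 * ((x0 - y) \<bullet> \<nu>)\<close>, positive by star-shapedness, while the
        derivative of \<open>u\<close> is at most 0. So \<open>u - w\<close> would decrease into the
        domain.\<close>
      have "((\<lambda>r. w (x0 + r *\<^sub>R - \<nu>) s0) has_real_derivative E s0 * (4 * q x0 s0 * ((x0 - y) \<bullet> \<nu>))) (at 0 within {0..d'})"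
        unfolding w_def q_def
        by (auto intro!: derivative_eq_intros simp: inner_commute algebra_simps)
      from DERIV_diff[OF du this]
      have "0 \<le> gradient_form x0 s0 (- \<nu>) - E s0 * (4 * q x0 s0 * ((x0 - y) \<bullet> \<nu>))"
      proof (rule one_sided_derivative_nonneg[OF d'(1)])
        fix r assume "0 \<le> r" "r \<le> d'"
        then show "u (x0 + 0 *\<^sub>R - \<nu>) s0 - w (x0 + 0 *\<^sub>R - \<nu>) s0
            \<le> u (x0 + r *\<^sub>R - \<nu>) s0 - w (x0 + r *\<^sub>R - \<nu>) s0"
          using min[OF cl[of r] x0(2,3)] e(2)[of r] d' by simp
      qed
      moreover have "0 < E s0 * (4 * q x0 s0 * ((x0 - y) \<bullet> \<nu>))"
        using E q0 out by simp
      ultimately show False using flux0 by simp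
    next
      case True
      define Q where "Q = q x0 s0"
      \<comment> \<open>Time is varied backward only, since \<open>s0\<close> may equal
        \<open>t2\<close>; positivity of \<open>q\<close> keeps the test points in
        \<open>K\<close>.\<close>
      have "isCont (\<lambda>r. q x0 (s0 - r)) 0"
        unfolding q_def h_def by (intro continuous_intros)
      then obtain e where e: "0 < e" "\<And>r. \<bar>r\<bar> < e \<Longrightarrow> 0 < q x0 (s0 - r)"
        by (rule isCont_pos_nbhd) (use q0 in auto)
      define d where "d = min e (s0 - t1) / 2"
      have d: "0 < d" "d < e" "d \<le> s0 - t1" using e s0 by (auto simp: d_def)
      have "((\<lambda>r. u x0 (s0 - r)) has_real_derivative - dt u x0 s0) (at 0 within {0..d})"
        using DERIV_chain2[of "u x0" "dt u x0 s0" "\<lambda>r. s0 - r" 0 "0 - 1" "{0..d}",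
            OF _ DERIV_diff[OF DERIV_const DERIV_ident]] has_time_derivative[OF True s0(2)]
        by simp
      moreover have "((\<lambda>r. w x0 (s0 - r)) has_real_derivative - (E s0 * (2 * Q * \<kappa> - \<mu> * Q\<^sup>2))) (at 0 within {0..d})"
        unfolding w_def q_def h_def E_def Q_def
        by (auto intro!: derivative_eq_intros simp: algebra_simps power2_eq_square)
      ultimately have "((\<lambda>r. u x0 (s0 - r) - w x0 (s0 - r)) has_real_derivative
          - dt u x0 s0 - - (E s0 * (2 * Q * \<kappa> - \<mu> * Q\<^sup>2))) (at 0 within {0..d})"
        by (rule DERIV_diff)
      then have "0 \<le> - dt u x0 s0 - - (E s0 * (2 * Q * \<kappa> - \<mu> * Q\<^sup>2))"
      proof (rule one_sided_derivative_nonneg[OF d(1)])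
        fix r assume "0 \<le> r" "r \<le> d"
        then show "u x0 (s0 - 0) - w x0 (s0 - 0) \<le> u x0 (s0 - r) - w x0 (s0 - r)"
          using min[OF x0(1), of "s0 - r"] e(2)[of r] d x0(3) by simp
      qed
      then have time: "dt u x0 s0 \<le> E s0 * (2 * Q * \<kappa> - \<mu> * Q\<^sup>2)" by simp
      \<comment> \<open>Second-order condition in direction \<open>b\<close>: the left-hand side is
        the second derivative of the barrier, a multiple of the square of a quadratic in
        \<open>r\<close>.\<close>
      have space: "E s0 * (8 * ((x0 - y) \<bullet> b)\<^sup>2 - 4 * Q) \<le> dx b (dx b u) x0 s0" if b: "b \<in> Basis" for b
      proof -
        have "isCont (\<lambda>r. q (x0 + r *\<^sub>R b) s0) 0"
          unfolding q_def by (intro continuous_intros)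
        then obtain e where e: "0 < e" "\<And>r. \<bar>r\<bar> < e \<Longrightarrow> 0 < q (x0 + r *\<^sub>R b) s0"
          by (rule isCont_pos_nbhd) (use q0 in auto)
        obtain e' where e': "0 < e'" "\<And>r. \<bar>r\<bar> < e' \<Longrightarrow> x0 + r *\<^sub>R b \<in> \<Omega>"
          using open_line_nbhd[OF open_domain True] by blast
        have bb: "b \<bullet> b = 1" using b by simp
        have q_line: "q (x0 + r *\<^sub>R b) s0 = Q - 2 * r * ((x0 - y) \<bullet> b) - r\<^sup>2" for r
          unfolding q_def Q_def
          by (simp add: inner_add_left inner_add_right inner_diff_left inner_diff_right bb
              inner_commute algebra_simps power2_eq_square)
        define B where "B = (x0 - y) \<bullet> b"
        have w_line: "w (x0 + r *\<^sub>R b) s0 = E s0 * (Q - 2 * r * B - r\<^sup>2)\<^sup>2" for r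
          by (simp add: w_def q_line B_def)
        have "0 \<le> dx b (dx b u) x0 s0 - E s0 * (8 * B\<^sup>2 - 4 * Q)"
        proof (rule second_derivative_nonneg_at_min[of "min e e'"
              "\<lambda>r. u (x0 + r *\<^sub>R b) s0 - w (x0 + r *\<^sub>R b) s0"
              "\<lambda>r. dx b u (x0 + r *\<^sub>R b) s0 - E s0 * (2 * (Q - 2 * r * B - r\<^sup>2) * (- 2 * B - 2 * r))"])
          show "0 < min e e'" using e e' by simp
          show "((\<lambda>r. u (x0 + r *\<^sub>R b) s0 - w (x0 + r *\<^sub>R b) s0) has_real_derivative
              dx b u (x0 + s *\<^sub>R b) s0 - E s0 * (2 * (Q - 2 * s * B - s\<^sup>2) * (- 2 * B - 2 * s))) (at s)"
            if "\<bar>s\<bar> < min e e'" for s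
          proof (rule DERIV_diff)
            show "((\<lambda>r. u (x0 + r *\<^sub>R b) s0) has_real_derivative dx b u (x0 + s *\<^sub>R b) s0) (at s)"
              by (rule has_line_derivative) (use s0 e' that b in auto)
            show "((\<lambda>r. w (x0 + r *\<^sub>R b) s0) has_real_derivative
                E s0 * (2 * (Q - 2 * s * B - s\<^sup>2) * (- 2 * B - 2 * s))) (at s)"
              unfolding w_line by (auto intro!: derivative_eq_intros simp: algebra_simps)
          qed
          show "((\<lambda>r. dx b u (x0 + r *\<^sub>R b) s0 - E s0 * (2 * (Q - 2 * r * B - r\<^sup>2) * (- 2 * B - 2 * r)))
              has_real_derivative dx b (dx b u) x0 s0 - E s0 * (8 * B\<^sup>2 - 4 * Q)) (at 0)"
          proof (rule DERIV_diff)
            show "((\<lambda>r. dx b u (x0 + r *\<^sub>R b) s0) has_real_derivative dx b (dx b u) x0 s0) (at 0)"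
              using has_second_line_derivative[of s0 x0 0 b] s0 True b by simp
            show "((\<lambda>r. E s0 * (2 * (Q - 2 * r * B - r\<^sup>2) * (- 2 * B - 2 * r))) has_real_derivative
                E s0 * (8 * B\<^sup>2 - 4 * Q)) (at 0)"
              by (auto intro!: derivative_eq_intros simp: algebra_simps power2_eq_square)
          qed
          show "u (x0 + 0 *\<^sub>R b) s0 - w (x0 + 0 *\<^sub>R b) s0 \<le> u (x0 + s *\<^sub>R b) s0 - w (x0 + s *\<^sub>R b) s0"
            if "\<bar>s\<bar> < min e e'" for s
            using min[of "x0 + s *\<^sub>R b" s0] e(2)[of s] e'(2)[of s] that closure_subset[of \<Omega>] x0 by auto
        qed
        then show ?thesis by (simp add: B_def)
      qed
      \<comment> \<open>The squared coordinates add up to the squared distance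
        \<open>h s0 - Q\<close>. The resulting term \<open>8 * h s0\<close> decides the matter for
        small \<open>Q\<close>, the decay rate \<open>\<mu>\<close> for large
        \<open>Q\<close>.\<close>
      have "(\<Sum>b\<in>Basis. ((x0 - y) \<bullet> b)\<^sup>2) = h s0 - Q"
        unfolding Q_def q_def by (subst (2) euclidean_inner) (simp add: power2_eq_square)
      then have "E s0 * (8 * (h s0 - Q) - 4 * real DIM('a) * Q)
          = (\<Sum>b\<in>(Basis::'a set). E s0 * (8 * ((x0 - y) \<bullet> b)\<^sup>2 - 4 * Q))"
        by (simp add: sum_distrib_left[symmetric] sum_subtractf)
      also have "\<dots> \<le> laplacian u x0 s0"
        unfolding laplacian_def by (rule sum_mono) (rule space)
      also have "\<dots> \<le> dt u x0 s0" by (rule super[OF True s0(2)])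
      also note time
      finally have "8 * (h s0 - Q) - 4 * real DIM('a) * Q \<le> 2 * Q * \<kappa> - \<mu> * Q\<^sup>2"
        using E[of s0] by simp
      then have quad: "\<mu> * Q\<^sup>2 - A * Q + 8 * h s0 \<le> 0"
        by (simp add: A_def algebra_simps)
      have "8 * \<rho>\<^sup>2 \<le> 8 * h s0" using h_le[OF x0(2)] by simp
      with quad have "\<mu> * Q\<^sup>2 - A * Q + 8 * \<rho>\<^sup>2 \<le> 0" by simp
      \<comment> \<open>Completing the square exhibits the negative discriminant.\<close>
      moreover have "\<mu> * Q\<^sup>2 - A * Q + 8 * \<rho>\<^sup>2 = (A * Q / (4 * \<rho>) - 2 * \<rho>)\<^sup>2 + 4 * \<rho>\<^sup>2"
        using \<rho> by (simp add: \<mu>_def power2_eq_square field_simps)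
      moreover have "0 < (A * Q / (4 * \<rho>) - 2 * \<rho>)\<^sup>2 + 4 * \<rho>\<^sup>2"
        using \<rho> by (intro add_nonneg_pos) auto
      ultimately show False by simp
    qed
  qed
  have "(dist y z)\<^sup>2 < R\<^sup>2" using z(2) by (intro power_strict_mono) auto
  then have qz: "0 < q z t2" by (simp add: q_def h2 inner_dist)
  then have "w z t2 \<le> u z t2" using z t by (intro compare) (auto simp: K_def)
  moreover have "0 < w z t2" using E qz by (simp add: w_def)
  ultimately show ?thesis by simp
qed

section \<open>Propagation of positivity to the whole closure\<close>

lemma positive_nbhd:
  assumes "x \<in> \<Omega>" "0 < t" "0 < u x t" "0 < R"
  obtains \<rho> where "0 < \<rho>" "\<rho> < R" "cball x \<rho> \<subseteq> \<Omega>" "\<And>z. z \<in> cball x \<rho> \<Longrightarrow> 0 < u z t"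
proof -
  have "isCont (\<lambda>y. u y t) x"
    by (rule has_derivative_continuous[OF has_space_derivative[OF assms(1,2)]])
  then have "eventually (\<lambda>y. 0 < u y t) (nhds x)"
    using assms(3) by (simp add: isCont_def eventually_nhds_conv_at order_tendstoD(1))
  moreover have "eventually (\<lambda>y. y \<in> \<Omega>) (nhds x)"
    using open_domain assms(1) by (rule eventually_nhds_in_open)
  ultimately have "eventually (\<lambda>y. y \<in> \<Omega> \<and> 0 < u y t) (nhds x)"
    by eventually_elim simp
  then obtain e where e: "0 < e" "\<And>y. dist y x < e \<Longrightarrow> y \<in> \<Omega> \<and> 0 < u y t"
    unfolding eventually_nhds_metric by blast
  define \<rho> where "\<rho> = min e R / 2"
  have \<rho>: "0 < \<rho>" "\<rho> < R" "\<rho> < e" using e(1) assms(4) by (auto simp: \<rho>_def)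
  have "y \<in> \<Omega> \<and> 0 < u y t" if "y \<in> cball x \<rho>" for y
    using that \<rho> by (intro e(2)) (simp add: dist_commute)
  with \<rho> show ?thesis by (intro that[of \<rho>]) blast+
qed

text \<open>A ball inside the open set meets no boundary, so the star-shapedness condition holds
  vacuously; continuity supplies the small starting ball.\<close>

lemma positive_in_ball:
  assumes "x \<in> \<Omega>" "ball x R \<subseteq> \<Omega>" "0 < s" "0 < u x s" "s < t" "z \<in> ball x R"
  shows "0 < u z t"
proof -
  have "0 < R" using assms(6) zero_le_dist[of x z] by (simp add: less_le_trans del: zero_le_dist)
  obtain \<rho> where \<rho>: "0 < \<rho>" "\<rho> < R" "cball x \<rho> \<subseteq> \<Omega>" "\<And>z. z \<in> cball x \<rho> \<Longrightarrow> 0 < u z s"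
    using positive_nbhd[OF assms(1,3,4) \<open>0 < R\<close>] by blast
  show ?thesis
  proof (rule positivity_spreads[OF \<rho>(1-3) assms(3,5) _ \<rho>(4)])
    show "0 < (v - x) \<bullet> unit_exterior_normal \<Omega> v" if "v \<in> frontier \<Omega>" "v \<in> ball x R" for v
      using that assms(2) open_domain by (auto simp: frontier_def interior_open)
    show "z \<in> closure \<Omega>" "z \<in> ball x R"
      using assms(2,6) closure_subset by blast+
  qed
qed

text \<open>Spreading within a ball takes arbitrarily little time. Hence the points positive at all
  times after \<open>t1\<close> form a nonempty set that is open and relatively closed, and
  connectedness applies.\<close>

lemma positive_in_domain:
  assumes "x1 \<in> \<Omega>" "0 < t1" "0 < u x1 t1" "x \<in> \<Omega>" "t1 < t"
  shows "0 < u x t"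
proof -
  define S where "S = {x \<in> \<Omega>. \<forall>t>t1. 0 < u x t}"
  have ball_S: "z \<in> S" if "y \<in> S" "ball y r \<subseteq> \<Omega>" "z \<in> ball y r" for y z r
    unfolding S_def
  proof (intro CollectI conjI allI impI)
    show "z \<in> \<Omega>" using that by blast
    fix t assume "t1 < t"
    \<comment> \<open>At the midpoint \<open>y\<close> is already positive; the second half of the
      time serves to spread from \<open>y\<close> to \<open>z\<close>.\<close>
    then have "t1 < (t1 + t) / 2" "(t1 + t) / 2 < t" by auto
    then show "0 < u z t"
      using that assms(2) by (intro positive_in_ball[of y r "(t1 + t) / 2" t z]) (auto simp: S_def)
  qed
  obtain r1 where r1: "0 < r1" "ball x1 r1 \<subseteq> \<Omega>"
    using open_domain assms(1) open_contains_ball by blast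
  then have "x1 \<in> S"
    unfolding S_def using assms(1-3) by (auto intro!: positive_in_ball[of x1 r1 t1])
  have "open S"
    unfolding open_contains_ball
  proof
    fix y assume "y \<in> S"
    then obtain r where "0 < r" "ball y r \<subseteq> \<Omega>"
      using open_domain open_contains_ball[of \<Omega>] by (auto simp: S_def)
    with ball_S[OF \<open>y \<in> S\<close>] show "\<exists>r>0. ball y r \<subseteq> S" by blast
  qed
  moreover have "open (\<Omega> - S)"
    unfolding open_contains_ball
  proof
    fix z assume z: "z \<in> \<Omega> - S"
    then obtain r where r: "0 < r" "ball z r \<subseteq> \<Omega>"
      using open_domain open_contains_ball[of \<Omega>] by blast
    \<comment> \<open>With half the radius the relation is symmetric: the ball of radius
      \<open>r / 2\<close> about \<open>y\<close> contains \<open>z\<close> and still lies in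
      \<open>\<Omega>\<close>, so \<open>y \<in> S\<close> would give
      \<open>z \<in> S\<close>.\<close>
    have "y \<notin> S" if "y \<in> ball z (r / 2)" for y
    proof
      assume "y \<in> S"
      have "ball y (r / 2) \<subseteq> ball z r"
        using that by (auto simp: ball_subset_ball_iff dist_commute)
      with r have "ball y (r / 2) \<subseteq> \<Omega>" by blast
      from ball_S[OF \<open>y \<in> S\<close> this, of z] that z show False by (simp add: dist_commute)
    qed
    moreover have "ball z (r / 2) \<subseteq> \<Omega>" using r subset_ball[of "r / 2" r z] by auto
    ultimately show "\<exists>e>0. ball z e \<subseteq> \<Omega> - S" using r(1) by (intro exI[of _ "r / 2"]) auto
  qed
  moreover have "S \<subseteq> \<Omega>" by (auto simp: S_def)
  ultimately have "\<Omega> - S = {}"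
    using connectedD[OF connected_domain, of S "\<Omega> - S"] \<open>x1 \<in> S\<close> by blast
  then show ?thesis using assms(4,5) by (auto simp: S_def)
qed

text \<open>At a boundary point, positivity first reaches the centre \<open>y\<close> of a
  star-shaped piece by the midpoint in time and then spreads from \<open>y\<close> to the
  boundary.\<close>

lemma positive_on_closure:
  assumes "x1 \<in> \<Omega>" "0 < t1" "0 < u x1 t1" "x \<in> closure \<Omega>" "t1 < t"
  shows "0 < u x t"
proof (cases "x \<in> \<Omega>")
  case True
  then show ?thesis using positive_in_domain assms by blast
next
  case False
  then have "x \<in> frontier \<Omega>" using assms(4) in_closure by blast
  then obtain y \<delta> where y: "0 < \<delta>" "y \<in> \<Omega>" "x \<in> ball y \<delta>"
    "\<And>x. x \<in> frontier \<Omega> \<Longrightarrow> x \<in> ball y \<delta> \<Longrightarrow> 0 < (x - y) \<bullet> unit_exterior_normal \<Omega> x"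
    using boundary_locally_star_shaped[OF domain] by metis
  define s where "s = (t1 + t) / 2"
  have s: "t1 < s" "s < t" "0 < s" using assms(2,5) by (auto simp: s_def)
  have "0 < u y s" using positive_in_domain[OF assms(1-3) y(2) s(1)] .
  then obtain \<rho> where \<rho>: "0 < \<rho>" "\<rho> < \<delta>" "cball y \<rho> \<subseteq> \<Omega>" "\<And>z. z \<in> cball y \<rho> \<Longrightarrow> 0 < u z s"
    using positive_nbhd[OF y(2) s(3) _ y(1)] by blast
  show ?thesis
    by (rule positivity_spreads[OF \<rho>(1-3) s(3,2) y(4) \<rho>(4) assms(4) y(3)])
qed

text \<open>The nonzero value may sit on the boundary or at time 0. Continuity on the closed
  cylinder moves it to an interior point and a positive time, from where positivity spreads.\<close>

lemma nontrivial_imp_eventually_positive: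
  assumes "nontrivial \<Omega> u"
  obtains t1 where "0 < t1" "\<And>x t. x \<in> closure \<Omega> \<Longrightarrow> t1 \<le> t \<Longrightarrow> 0 < u x t"
proof -
  obtain x0 t0 where x0: "x0 \<in> closure \<Omega>" "0 \<le> t0" "u x0 t0 \<noteq> 0"
    using assms by (auto simp: nontrivial_def)
  then have pos: "0 < u x0 t0" using nonneg[OF x0(1,2)] by simp
  have "\<forall>\<epsilon>>0. \<exists>d>0. \<forall>p\<in>closure \<Omega> \<times> {0..t0 + 1}. dist p (x0, t0) < d \<longrightarrow>
      dist ((\<lambda>(x, t). u x t) p) ((\<lambda>(x, t). u x t) (x0, t0)) < \<epsilon>"
    using continuous_u[of 0 "t0 + 1"] x0 unfolding continuous_on_iff by auto
  with pos obtain d where d: "0 < d" "\<And>x t. x \<in> closure \<Omega> \<Longrightarrow> t \<in> {0..t0 + 1} \<Longrightarrow>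
      dist (x, t) (x0, t0) < d \<Longrightarrow> dist (u x t) (u x0 t0) < u x0 t0"
    by (force simp del: dist_Pair_Pair)
  obtain x1 where x1: "x1 \<in> \<Omega>" "dist x1 x0 < d / 2"
    using x0(1) d(1) unfolding closure_approachable by (metis half_gt_zero)
  \<comment> \<open>The bound 1 keeps \<open>t1\<close> in the interval where continuity was
    invoked, and \<open>d / 4\<close> leaves room for the displacement in space. The shift makes
    \<open>t1\<close> positive even if \<open>t0 = 0\<close>.\<close>
  define t1 where "t1 = t0 + min 1 (d / 4)"
  have t1: "0 < t1" "t0 < t1" "t1 \<le> t0 + 1" "dist t1 t0 < d / 2"
    using x0(2) d(1) by (auto simp: t1_def dist_real_def)
  have "dist (x1, t1) (x0, t0) \<le> dist x1 x0 + dist t1 t0"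
    by (simp add: dist_Pair_Pair sqrt_sum_squares_le_sum)
  then have "dist (x1, t1) (x0, t0) < d" using x1 t1 by simp
  then have "dist (u x1 t1) (u x0 t0) < u x0 t0"
    using x1 t1 x0 closure_subset[of \<Omega>] by (intro d(2)) auto
  then have "0 < u x1 t1" by (simp add: dist_real_def abs_if split: if_splits)
  \<comment> \<open>Positivity is known strictly after \<open>t1\<close>; starting at
    \<open>t1 + 1\<close> permits the non-strict inequality.\<close>
  with positive_on_closure[OF x1(1) t1(1)] t1(1) show ?thesis
    by (intro that[of "t1 + 1"]) auto
qed

section \<open>Bound for the time integral of the flux coefficient\<close>

text \<open>At the minimum point \<open>x0\<close>, concavity of \<open>F\<close> allows us to replace \<open>F(u)\<close> by its
  linearisation at \<open>u(x0,t)\<close>: although \<open>g\<close> need not be differentiable, only \<open>u\<close> has to be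
  differentiated twice.\<close>

lemma flux_integral_bound:
  fixes \<beta> g F :: "real \<Rightarrow> real"
  assumes t: "0 < t0" "t0 < T"
    and pos: "\<And>x t. x \<in> closure \<Omega> \<Longrightarrow> t0 \<le> t \<Longrightarrow> 0 < u x t"
    and g: "mono_on {0<..} g" "\<And>s. 0 < s \<Longrightarrow> 0 < g s" "continuous_on {0<..} g"
    and F: "\<And>s. 0 < s \<Longrightarrow> (F has_real_derivative 1 / g s) (at s)"
    and flux_eq: "\<And>x t. x \<in> frontier \<Omega> \<Longrightarrow> t0 \<le> t \<Longrightarrow>
      normal_derivative \<Omega> (\<lambda>y. u y t) x = \<beta> t * g (u x t)"
    and M: "\<And>x. x \<in> \<Omega> \<Longrightarrow> F (u x T) - F (u x t0) \<le> M"
    and R: "0 < R" "\<And>x. x \<in> closure \<Omega> \<Longrightarrow> norm x \<le> R"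
  shows "integral {t0..T} \<beta> \<le> max 0 (2 * R * M)"
proof (rule ccontr)
  define B where "B = integral {t0..T} \<beta>"
  assume "\<not> integral {t0..T} \<beta> \<le> max 0 (2 * R * M)"
  then have B: "0 < B" "2 * R * M < B" by (auto simp: B_def)
  \<comment> \<open>A compromise: \<open>2 * B * \<epsilon> * R = B / 2\<close> is too small to
    balance the flux \<open>B\<close> at the boundary, while
    \<open>2 * B * \<epsilon> = B / (2 * R)\<close> still exceeds \<open>M\<close> in the
    interior.\<close>
  define \<epsilon> where "\<epsilon> = 1 / (4 * R)"
  have contu: "continuous_on (closure \<Omega> \<times> {t0..T}) (\<lambda>(x, t). u x t)"
    using t by (intro continuous_u) simp
  have contF: "continuous_on {0<..} F"
    using F by (auto intro!: continuous_at_imp_continuous_on DERIV_isCont)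
  have contFu: "continuous_on (closure \<Omega> \<times> {t0..T}) (\<lambda>(x, t). F (u x t))"
  proof -
    have "continuous_on (closure \<Omega> \<times> {t0..T}) (\<lambda>p. F (case p of (x, t) \<Rightarrow> u x t))"
      by (rule continuous_on_compose2[OF contF contu]) (use pos in auto)
    then show ?thesis by (simp add: case_prod_unfold)
  qed
  define J where "J y = integral {t0..T} (\<lambda>t. F (u y t))" for y
  have contJ: "continuous_on (closure \<Omega>) J"
    using integral_continuous_on_param[of "closure \<Omega>" t0 T "\<lambda>x t. F (u x t)"] contFu
    by (simp add: J_def)
  have "continuous_on (closure \<Omega>) (\<lambda>y. J y - B * \<epsilon> * (y \<bullet> y))"
    by (intro continuous_intros contJ)
  moreover have "closure \<Omega> \<noteq> {}" using domain by (simp add: bounded_smooth_domain_def)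
  ultimately obtain x0 where x0: "x0 \<in> closure \<Omega>"
    and x0_min: "\<And>y. y \<in> closure \<Omega> \<Longrightarrow> J x0 - B * \<epsilon> * (x0 \<bullet> x0) \<le> J y - B * \<epsilon> * (y \<bullet> y)"
    using continuous_attains_inf[OF compact_closure_domain, of "\<lambda>y. J y - B * \<epsilon> * (y \<bullet> y)"] by blast
  \<comment> \<open>The slope of \<open>F\<close> at \<open>u x0 t\<close>, frozen in space, serves
    as a weight depending on time only.\<close>
  define k where "k t = 1 / g (u x0 t)" for t
  have contux0: "continuous_on {t0..T} (u x0)" by (rule continuous_on_slice[OF contu x0])
  have k: "0 < k t" if "t \<in> {t0..T}" for t
    using that g(2) pos[OF x0] by (simp add: k_def)
  have contk: "continuous_on {t0..T} k"
  proof -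
    have "continuous_on {t0..T} (\<lambda>t. g (u x0 t))"
      by (rule continuous_on_compose2[OF g(3) contux0]) (use pos[OF x0] in auto)
    then show ?thesis
      unfolding k_def by (intro continuous_intros) (use g(2) pos[OF x0] in \<open>force\<close>)+
  qed
  have contk2: "continuous_on (A \<times> {t0..T}) (\<lambda>p. k (snd p))" for A :: "real set"
    by (rule continuous_on_compose2[OF contk]) (auto intro!: continuous_intros)
  define Z where "Z y = integral {t0..T} (\<lambda>t. k t * u y t)" for y
  have contku: "continuous_on {t0..T} (\<lambda>t. k t * u y t)" if "y \<in> closure \<Omega>" for y
    by (intro continuous_intros contk continuous_on_slice[OF contu that])
  \<comment> \<open>Tangent-line inequality: the slope \<open>1 / g\<close> is
    nonincreasing.\<close>
  have concave: "F s - F r \<le> 1 / g r * (s - r)" if rs: "0 < r" "0 < s" for r s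
  proof (cases r s rule: linorder_cases)
    case less
    have "\<exists>z. r < z \<and> z < s \<and> F s - F r = (s - r) * (1 / g z)"
      by (rule MVT2[OF less]) (use F rs in auto)
    then obtain z where z: "r < z" "z < s" "F s - F r = (s - r) * (1 / g z)" by auto
    have "1 / g z \<le> 1 / g r"
      using mono_onD[OF g(1), of r z] g(2)[of r] g(2)[of z] rs z by (simp add: frac_le)
    then have "(s - r) * (1 / g z) \<le> (s - r) * (1 / g r)"
      using less by (intro mult_left_mono) auto
    then show ?thesis using z(3) by (simp add: algebra_simps)
  next
    case greater
    have "\<exists>z. s < z \<and> z < r \<and> F r - F s = (r - s) * (1 / g z)"
      by (rule MVT2[OF greater]) (use F rs in auto)
    then obtain z where z: "s < z" "z < r" "F r - F s = (r - s) * (1 / g z)" by auto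
    have "1 / g r \<le> 1 / g z"
      using mono_onD[OF g(1), of z r] g(2)[of r] g(2)[of z] rs z by (simp add: frac_le)
    then have "(r - s) * (1 / g r) \<le> (r - s) * (1 / g z)"
      using greater by (intro mult_left_mono) auto
    then show ?thesis using z(3) by (simp add: algebra_simps diff_divide_distrib)
  qed simp
  \<comment> \<open>The linearisation dominates increments,
    \<open>J y - J x0 \<le> Z y - Z x0\<close>, so minimality at \<open>x0\<close> passes from
    \<open>J\<close> to \<open>Z\<close>.\<close>
  have Z_min: "Z x0 - B * \<epsilon> * (x0 \<bullet> x0) \<le> Z y - B * \<epsilon> * (y \<bullet> y)" if y: "y \<in> closure \<Omega>" for y
  proof -
    have int: "(\<lambda>t. F (u v t)) integrable_on {t0..T}" "(\<lambda>t. k t * u v t) integrable_on {t0..T}"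
      if "v \<in> closure \<Omega>" for v
      using that by (intro integrable_continuous_real continuous_on_slice[OF contFu] contku; simp)+
    have "J y - J x0 = integral {t0..T} (\<lambda>t. F (u y t) - F (u x0 t))"
      unfolding J_def using int x0 y by (simp add: integral_diff)
    also have "\<dots> \<le> integral {t0..T} (\<lambda>t. k t * u y t - k t * u x0 t)"
    proof (rule integral_le)
      fix t assume "t \<in> {t0..T}"
      then show "F (u y t) - F (u x0 t) \<le> k t * u y t - k t * u x0 t"
        using concave[of "u x0 t" "u y t"] pos x0 y by (simp add: k_def algebra_simps)
    qed (use int x0 y in \<open>auto intro!: integrable_diff\<close>)
    also have "\<dots> = Z y - Z x0"
      unfolding Z_def using int x0 y by (simp add: integral_diff)
    finally show ?thesis using x0_min[OF y] by simp
  qed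
  show False
  proof (cases "x0 \<in> \<Omega>")
    case False
    then have fr: "x0 \<in> frontier \<Omega>" using x0 in_closure by blast
    define \<nu> where "\<nu> = unit_exterior_normal \<Omega> x0"
    obtain d where d: "0 < d" "\<And>s. 0 < s \<Longrightarrow> s \<le> d \<Longrightarrow> x0 - s *\<^sub>R \<nu> \<in> \<Omega>"
      using inward_segment[OF domain fr] unfolding \<nu>_def by blast
    have cl: "x0 + s *\<^sub>R - \<nu> \<in> closure \<Omega>" if "s \<in> {0..d}" for s
      using d(2)[of s] that x0 closure_subset[of \<Omega>] by (cases "s = 0") auto
    have "((\<lambda>s. Z (x0 + s *\<^sub>R - \<nu>)) has_real_derivative
        integral {t0..T} (\<lambda>t. k t * gradient_form (x0 + 0 *\<^sub>R - \<nu>) t (- \<nu>))) (at 0 within {0..d})"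
      unfolding Z_def
    proof (rule leibniz_rule_real)
      fix s t assume st: "s \<in> {0..d}" "t \<in> {t0..T}"
      show "((\<lambda>s. k t * u (x0 + s *\<^sub>R - \<nu>) t) has_real_derivative
          k t * gradient_form (x0 + s *\<^sub>R - \<nu>) t (- \<nu>)) (at s within {0..d})"
        by (intro DERIV_cmult has_real_derivative_along_line[where S = "closure \<Omega>"]
            has_derivative_closure cl st) (use st t in auto)
    next
      have "continuous_on ({0..d} \<times> {t0..T})
          (\<lambda>p. (case (x0 + fst p *\<^sub>R - \<nu>, snd p) of (x, t) \<Rightarrow> gradient_form x t (- \<nu>)))"
        by (rule continuous_on_compose2[OF continuous_gradient_form[of t0 T]])
           (use t cl in \<open>auto intro!: continuous_intros\<close>)
      then show "continuous_on ({0..d} \<times> {t0..T}) (\<lambda>(s, t). k t * gradient_form (x0 + s *\<^sub>R - \<nu>) t (- \<nu>))"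
        unfolding case_prod_unfold by (intro continuous_on_mult contk2) simp
    qed (use d cl contku in auto)
    \<comment> \<open>At \<open>x0\<close> the weight cancels the factor \<open>g (u x0 t)\<close>
      of the boundary condition, leaving only \<open>\<beta>\<close>.\<close>
    also have "integral {t0..T} (\<lambda>t. k t * gradient_form (x0 + 0 *\<^sub>R - \<nu>) t (- \<nu>))
        = integral {t0..T} (\<lambda>t. - \<beta> t)"
    proof (rule integral_cong)
      fix t assume tt: "t \<in> {t0..T}"
      then have "gradient_form x0 t (- \<nu>) = - (\<beta> t * g (u x0 t))"
        using linear_neg[OF has_derivative_linear[OF has_derivative_closure[OF x0, of t]]]
          flux_eq[OF fr, of t] t
        by (simp add: normal_derivative_def \<nu>_def)
      then show "k t * gradient_form (x0 + 0 *\<^sub>R - \<nu>) t (- \<nu>) = - \<beta> t"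
        using g(2)[OF pos[OF x0, of t]] tt by (simp add: k_def)
    qed
    also have "\<dots> = - B" by (simp add: B_def)
    finally have dZ: "((\<lambda>s. Z (x0 + s *\<^sub>R - \<nu>)) has_real_derivative - B) (at 0 within {0..d})" .
    have "((\<lambda>s. B * \<epsilon> * ((x0 + s *\<^sub>R - \<nu>) \<bullet> (x0 + s *\<^sub>R - \<nu>))) has_real_derivative
        - (2 * B * \<epsilon> * (x0 \<bullet> \<nu>))) (at 0 within {0..d})"
    proof -
      have "(x0 + s *\<^sub>R - \<nu>) \<bullet> (x0 + s *\<^sub>R - \<nu>) = x0 \<bullet> x0 - 2 * s * (x0 \<bullet> \<nu>) + s\<^sup>2 * (\<nu> \<bullet> \<nu>)" for s
        by (simp add: inner_diff_left inner_diff_right inner_commute algebra_simps power2_eq_square)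
      then show ?thesis by (auto intro!: derivative_eq_intros)
    qed
    \<comment> \<open>Minimality along the inward normal, combined with
      \<open>x0 \<bullet> \<nu> \<le> R\<close>, yields the contradiction
      \<open>0 \<le> - B / 2\<close>.\<close>
    from DERIV_diff[OF dZ this]
    have "0 \<le> - B - - (2 * B * \<epsilon> * (x0 \<bullet> \<nu>))"
      by (rule one_sided_derivative_nonneg[OF d(1)]) (use Z_min cl in auto)
    moreover have "x0 \<bullet> \<nu> \<le> R"
      using norm_cauchy_schwarz[of x0 \<nu>] norm_unit_exterior_normal[OF domain fr] R(2)[OF x0]
      by (simp add: \<nu>_def)
    then have "2 * B * \<epsilon> * (x0 \<bullet> \<nu>) \<le> 2 * B * \<epsilon> * R"
      using B R by (intro mult_left_mono) (auto simp: \<epsilon>_def)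
    moreover have "2 * B * \<epsilon> * R = B / 2" using R by (simp add: \<epsilon>_def)
    ultimately show False using B by simp
  next
    case True
    \<comment> \<open>At an interior minimum each pure second derivative of \<open>Z\<close> is at
      least that of the quadratic term; both differentiations pass under the integral.\<close>
    have second: "2 * B * \<epsilon> \<le> integral {t0..T} (\<lambda>t. k t * dx b (dx b u) x0 t)"
      if b: "b \<in> Basis" for b
    proof -
      obtain e where e: "0 < e" "\<And>s. \<bar>s\<bar> < e \<Longrightarrow> x0 + s *\<^sub>R b \<in> \<Omega>"
        using open_line_nbhd[OF open_domain True] by blast
      define U where "U = {-e<..<e}"
      have U: "open U" "convex U" "0 \<in> U" using e by (auto simp: U_def)
      have inU: "x0 + s *\<^sub>R b \<in> \<Omega>" if "s \<in> U" for s using that by (intro e(2)) (auto simp: U_def)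
      then have inU': "x0 + s *\<^sub>R b \<in> closure \<Omega>" if "s \<in> U" for s
        using that closure_subset by blast
      have bb: "b \<bullet> b = 1" using b by simp
      have cont1: "continuous_on (U \<times> {t0..T}) (\<lambda>(s, t). k t * dx b u (x0 + s *\<^sub>R b) t)"
      proof -
        have "continuous_on (U \<times> {t0..T}) (\<lambda>p. case (x0 + fst p *\<^sub>R b, snd p) of (x, t) \<Rightarrow> dx b u x t)"
          by (rule continuous_on_compose2[OF continuous_space_derivative[OF t(1) b, of T]])
             (use inU in \<open>auto intro!: continuous_intros\<close>)
        then show ?thesis
          unfolding case_prod_unfold by (intro continuous_on_mult contk2) simp
      qed
      have cont2: "continuous_on (U \<times> {t0..T}) (\<lambda>(s, t). k t * dx b (dx b u) (x0 + s *\<^sub>R b) t)"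
      proof -
        have "continuous_on (U \<times> {t0..T}) (\<lambda>p. case (x0 + fst p *\<^sub>R b, snd p) of (x, t) \<Rightarrow> dx b (dx b u) x t)"
          by (rule continuous_on_compose2[OF continuous_second_space_derivative[OF t(1) b, of T]])
             (use inU in \<open>auto intro!: continuous_intros\<close>)
        then show ?thesis
          unfolding case_prod_unfold by (intro continuous_on_mult contk2) simp
      qed
      define Z1 where "Z1 s = integral {t0..T} (\<lambda>t. k t * dx b u (x0 + s *\<^sub>R b) t)" for s
      have dZ: "((\<lambda>s. Z (x0 + s *\<^sub>R b)) has_real_derivative Z1 s) (at s)" if "s \<in> U" for s
        unfolding Z_def Z1_def at_within_open[OF that U(1), symmetric]
        by (rule leibniz_rule_real[OF _ _ cont1 that U(2)])
           (use inU inU' t b contku in \<open>auto intro!: DERIV_cmult has_field_derivative_at_within[OF has_line_derivative]\<close>)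
      have dZ1: "(Z1 has_real_derivative integral {t0..T} (\<lambda>t. k t * dx b (dx b u) (x0 + 0 *\<^sub>R b) t)) (at 0)"
        unfolding Z1_def at_within_open[OF U(3,1), symmetric]
        by (rule leibniz_rule_real[OF _ continuous_on_slice[OF cont1] cont2 U(3,2)])
           (use inU t b in \<open>auto intro!: DERIV_cmult has_field_derivative_at_within[OF has_second_line_derivative]\<close>)
      have sq: "(x0 + s *\<^sub>R b) \<bullet> (x0 + s *\<^sub>R b) = x0 \<bullet> x0 + 2 * s * (x0 \<bullet> b) + s\<^sup>2" for s
        by (simp add: inner_add_left inner_add_right bb inner_commute algebra_simps power2_eq_square)
      have "0 \<le> integral {t0..T} (\<lambda>t. k t * dx b (dx b u) (x0 + 0 *\<^sub>R b) t) - B * \<epsilon> * 2"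
      proof (rule second_derivative_nonneg_at_min[OF e(1),
            where f = "\<lambda>s. Z (x0 + s *\<^sub>R b) - B * \<epsilon> * (x0 \<bullet> x0 + 2 * s * (x0 \<bullet> b) + s\<^sup>2)"
              and f' = "\<lambda>s. Z1 s - B * \<epsilon> * (2 * (x0 \<bullet> b) + 2 * s)"])
        fix s assume "\<bar>s\<bar> < e"
        then have s: "s \<in> U" by (auto simp: U_def)
        show "((\<lambda>s. Z (x0 + s *\<^sub>R b) - B * \<epsilon> * (x0 \<bullet> x0 + 2 * s * (x0 \<bullet> b) + s\<^sup>2)) has_real_derivative
            Z1 s - B * \<epsilon> * (2 * (x0 \<bullet> b) + 2 * s)) (at s)"
          by (rule DERIV_diff[OF dZ[OF s]]) (auto intro!: derivative_eq_intros)
        show "Z (x0 + 0 *\<^sub>R b) - B * \<epsilon> * (x0 \<bullet> x0 + 2 * 0 * (x0 \<bullet> b) + 0\<^sup>2)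
            \<le> Z (x0 + s *\<^sub>R b) - B * \<epsilon> * (x0 \<bullet> x0 + 2 * s * (x0 \<bullet> b) + s\<^sup>2)"
          using Z_min[OF inU'[OF s]] by (simp add: sq)
      next
        show "((\<lambda>s. Z1 s - B * \<epsilon> * (2 * (x0 \<bullet> b) + 2 * s)) has_real_derivative
            integral {t0..T} (\<lambda>t. k t * dx b (dx b u) (x0 + 0 *\<^sub>R b) t) - B * \<epsilon> * 2) (at 0)"
          by (rule DERIV_diff[OF dZ1]) (auto intro!: derivative_eq_intros)
      qed
      then show ?thesis by simp
    qed
    have cont_dxx: "continuous_on {t0..T} (\<lambda>t. k t * dx b (dx b u) x0 t)" if "b \<in> Basis" for b
      by (intro continuous_intros contk
          continuous_on_slice[OF continuous_second_space_derivative[OF t(1) that] True])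
    \<comment> \<open>The dimension is at least 1, so the contribution of one coordinate is a lower
      bound for the sum.\<close>
    have "2 * B * \<epsilon> \<le> real DIM('a) * (2 * B * \<epsilon>)"
      using mult_right_mono[of 1 "real DIM('a)" "2 * B * \<epsilon>"] B R
      by (simp add: \<epsilon>_def Suc_le_eq del: mult_le_cancel_right mult_le_cancel_right1)
    also have "\<dots> = (\<Sum>b\<in>(Basis::'a set). 2 * B * \<epsilon>)" by simp
    also have "\<dots> \<le> (\<Sum>b\<in>Basis. integral {t0..T} (\<lambda>t. k t * dx b (dx b u) x0 t))"
      by (rule sum_mono) (rule second)
    also have "\<dots> = integral {t0..T} (\<lambda>t. \<Sum>b\<in>Basis. k t * dx b (dx b u) x0 t)"
      by (rule integral_sum[symmetric]) (auto intro!: integrable_continuous_real cont_dxx)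
    also have "\<dots> = integral {t0..T} (\<lambda>t. k t * laplacian u x0 t)"
      by (simp add: laplacian_def sum_distrib_left)
    also have "\<dots> \<le> integral {t0..T} (\<lambda>t. k t * dt u x0 t)"
    proof (rule integral_le)
      have "continuous_on {t0..T} (\<lambda>t. \<Sum>b\<in>Basis. k t * dx b (dx b u) x0 t)"
        by (intro continuous_on_sum cont_dxx)
      then show "(\<lambda>t. k t * laplacian u x0 t) integrable_on {t0..T}"
        by (simp add: laplacian_def sum_distrib_left integrable_continuous_real)
      show "(\<lambda>t. k t * dt u x0 t) integrable_on {t0..T}"
        by (intro integrable_continuous_real continuous_intros contk
            continuous_on_slice[OF continuous_time_derivative[OF t(1)] True])
      show "k t * laplacian u x0 t \<le> k t * dt u x0 t" if "t \<in> {t0..T}" for t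
        using that k[OF that] super[OF True, of t] t by (intro mult_left_mono) auto
    qed
    \<comment> \<open>Along \<open>u x0\<close> the weight is exactly the derivative of
      \<open>F\<close>, so the integrand is the time derivative of
      \<open>F (u x0 t)\<close>.\<close>
    also have "\<dots> = F (u x0 T) - F (u x0 t0)"
    proof (rule integral_unique, rule fundamental_theorem_of_calculus)
      show "t0 \<le> T" using t by simp
      fix s assume s: "s \<in> {t0..T}"
      then have "((\<lambda>t. F (u x0 t)) has_real_derivative 1 / g (u x0 s) * dt u x0 s) (at s)"
        using t pos[OF x0, of s] by (intro DERIV_chain2[OF F has_time_derivative[OF True]]) auto
      then show "((\<lambda>t. F (u x0 t)) has_vector_derivative k s * dt u x0 s) (at s within {t0..T})"
        unfolding has_real_derivative_iff_has_vector_derivative[symmetric] k_def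
        by (rule has_field_derivative_at_within)
    qed
    also have "\<dots> \<le> M" by (rule M[OF True])
    finally have "B / (2 * R) \<le> M" by (simp add: \<epsilon>_def)
    then show False using B R by (simp add: field_simps)
  qed
qed

end

section \<open>Nonexistence of nontrivial global solutions\<close>

theorem theorem2p2:
  fixes \<Omega> :: "'a::euclidean_space set"
    and f g \<alpha> \<beta> :: "real \<Rightarrow> real"
    and u0 :: "'a \<Rightarrow> real"
  assumes "bounded_smooth_domain \<Omega>"
    and "continuous_on {0..} f" and "\<And>s. 0 \<le> s \<Longrightarrow> 0 \<le> f s"
    and "continuous_on {0..} g" and "\<And>s. 0 \<le> s \<Longrightarrow> 0 \<le> g s"
    and "continuous_on {0..} \<alpha>" and "\<And>t. 0 \<le> t \<Longrightarrow> 0 \<le> \<alpha> t"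
    and "continuous_on {0..} \<beta>" and "\<And>t. 0 \<le> t \<Longrightarrow> 0 \<le> \<beta> t"
    and "C1_closure \<Omega> u0" and "\<And>x. x \<in> closure \<Omega> \<Longrightarrow> 0 \<le> u0 x"
    and "\<And>x. x \<in> frontier \<Omega> \<Longrightarrow> normal_derivative \<Omega> u0 x = \<beta> 0 * g (u0 x)"
    and "mono_on {0<..} g" and "\<And>s. 0 < s \<Longrightarrow> 0 < g s"
    and "\<exists>a>0. (\<integral>\<^sup>+ s\<in>{a..}. ennreal (1 / g s) \<partial>lborel) < \<infinity>"
    and "(\<integral>\<^sup>+ t\<in>{0..}. ennreal (\<beta> t) \<partial>lborel) = \<infinity>"
  shows "\<not> (\<exists>u. global_nonneg_classical_solution \<Omega> f g \<alpha> \<beta> u0 u \<and> nontrivial \<Omega> u)"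
proof
  assume "\<exists>u. global_nonneg_classical_solution \<Omega> f g \<alpha> \<beta> u0 u \<and> nontrivial \<Omega> u"
  then obtain u where u: "global_nonneg_classical_solution \<Omega> f g \<alpha> \<beta> u0 u" "nontrivial \<Omega> u"
    by blast
  have sol: "nonneg_classical_solution \<Omega> f g \<alpha> \<beta> u0 T u" if "0 < T" for T
    using u(1) that by (simp add: global_nonneg_classical_solution_def)
  have sol_nonneg: "\<forall>(x, t)\<in>cylinder \<Omega> T \<union> parabolic_boundary \<Omega> T. 0 \<le> u x t"
    and sol_pde: "\<forall>(x, t)\<in>cylinder \<Omega> T. dt u x t = laplacian u x t + \<alpha> t * f (u x t)"
    and sol_bc: "\<forall>(x, t)\<in>lateral_boundary \<Omega> T.
      normal_derivative \<Omega> (\<lambda>y. u y t) x = \<beta> t * g (u x t)" if "0 < T" for T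
    using sol[OF that] unfolding nonneg_classical_solution_def by blast+
  have u_nonneg: "0 \<le> u x t" if "x \<in> closure \<Omega>" "0 \<le> t" for x t
  proof -
    have "(x, t) \<in> cylinder \<Omega> (t + 1) \<union> parabolic_boundary \<Omega> (t + 1)"
      using that closure_Un_frontier[of \<Omega>]
      by (auto simp: cylinder_def parabolic_boundary_def lateral_boundary_def)
    with sol_nonneg[of "t + 1"] that show ?thesis by auto
  qed
  have pde: "dt u x t = laplacian u x t + \<alpha> t * f (u x t)" if "x \<in> \<Omega>" "0 < t" for x t
  proof -
    have "(x, t) \<in> cylinder \<Omega> (t + 1)" using that by (simp add: cylinder_def)
    with sol_pde[of "t + 1"] that show ?thesis by auto
  qed
  have bc: "normal_derivative \<Omega> (\<lambda>y. u y t) x = \<beta> t * g (u x t)" if "x \<in> frontier \<Omega>" "0 < t" for x t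
  proof -
    have "(x, t) \<in> lateral_boundary \<Omega> (t + 1)" using that by (simp add: lateral_boundary_def)
    with sol_bc[of "t + 1"] that show ?thesis by auto
  qed
  \<comment> \<open>Both the source \<open>\<alpha> t * f (u x t)\<close> and the flux
    \<open>\<beta> t * g (u x t)\<close> are nonnegative.\<close>
  interpret neumann_supersolution \<Omega> u
  proof
    show "bounded_smooth_domain \<Omega>" by fact
    show "C21 \<Omega> T u" "C10 \<Omega> T u" if "0 < T" for T
      using sol[OF that] by (auto simp: nonneg_classical_solution_def)
    show "0 \<le> u x t" if "x \<in> closure \<Omega>" "0 \<le> t" for x t by (rule u_nonneg[OF that])
    show "laplacian u x t \<le> dt u x t" if "x \<in> \<Omega>" "0 < t" for x t
      using pde[OF that] u_nonneg[of x t] closure_subset[of \<Omega>] that assms(3,7) by auto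
    show "0 \<le> normal_derivative \<Omega> (\<lambda>y. u y t) x" if "x \<in> frontier \<Omega>" "0 < t" for x t
      using bc[OF that] u_nonneg[of x t] that assms(5,9) by (auto simp: frontier_def)
  qed
  obtain t0 where t0: "0 < t0" "\<And>x t. x \<in> closure \<Omega> \<Longrightarrow> t0 \<le> t \<Longrightarrow> 0 < u x t"
    using nontrivial_imp_eventually_positive[OF u(2)] by blast
  \<comment> \<open>The positive minimum of \<open>u\<close> at time \<open>t0\<close> is the
    cut-off that makes the bound \<open>M\<close> on the increase of \<open>F\<close> independent of
    \<open>x\<close> and of the final time.\<close>
  have "continuous_on (closure \<Omega>) (\<lambda>x. (\<lambda>(x, t). u x t) (x, t0))"
    by (rule continuous_on_compose2[OF continuous_u[of 0 t0]])
       (use t0 in \<open>auto intro!: continuous_intros\<close>)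
  moreover have "closure \<Omega> \<noteq> {}" using assms(1) by (simp add: bounded_smooth_domain_def)
  ultimately obtain x1 where x1: "x1 \<in> closure \<Omega>" "\<And>x. x \<in> closure \<Omega> \<Longrightarrow> u x1 t0 \<le> u x t0"
    using continuous_attains_inf[OF compact_closure_domain] by force
  have contg: "continuous_on {0<..} g"
    by (rule continuous_on_subset[OF assms(4)]) auto
  then have contg': "isCont (\<lambda>s. 1 / g s) s" if "0 < s" for s
    using that assms(14)[OF that] by (auto simp: continuous_on_eq_continuous_at intro!: continuous_intros)
  obtain F where F: "\<And>s. 0 < s \<Longrightarrow> (F has_real_derivative 1 / g s) (at s)"
    using antiderivative_exists[of "\<lambda>s. 1 / g s"] contg' by blast
  obtain a where a: "0 < a" "(\<integral>\<^sup>+ s\<in>{a..}. ennreal (1 / g s) \<partial>lborel) < \<infinity>"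
    using assms(15) by blast
  have "0 \<le> 1 / g s" if "0 < s" for s using assms(14)[OF that] by simp
  moreover have "0 < u x1 t0" using t0 x1 by simp
  ultimately obtain M where M: "\<And>s r. u x1 t0 \<le> r \<Longrightarrow> 0 < s \<Longrightarrow> F s - F r \<le> M"
    using antiderivative_bounded[OF F contg' _ a] by metis
  obtain R where R: "0 < R" "\<And>x. x \<in> closure \<Omega> \<Longrightarrow> norm x \<le> R"
    using compact_imp_bounded[OF compact_closure_domain] unfolding bounded_pos by blast
  \<comment> \<open>\<open>M\<close> and \<open>R\<close> are fixed before \<open>T\<close>, so
    divergence of the integral of \<open>\<beta>\<close> lets \<open>T\<close> violate the flux
    bound.\<close>
  obtain T where T: "t0 < T" "max 0 (2 * R * M) < integral {t0..T} \<beta>"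
    by (rule integral_unbounded_of_nn_integral_infinite[OF assms(8,9,16) less_imp_le[OF t0(1)]])
  have "integral {t0..T} \<beta> \<le> max 0 (2 * R * M)"
  proof (rule flux_integral_bound[OF t0(1) T(1) t0(2) assms(13,14) contg F _ _ R])
    show "normal_derivative \<Omega> (\<lambda>y. u y t) x = \<beta> t * g (u x t)" if "x \<in> frontier \<Omega>" "t0 \<le> t" for x t
      using bc that t0(1) by simp
    show "F (u x T) - F (u x t0) \<le> M" if "x \<in> \<Omega>" for x
      using M[of "u x t0" "u x T"] x1(2)[of x] t0(2)[of x T] T(1) that closure_subset[of \<Omega>] by auto
  qed
  with T(2) show False by linarith
qed

end
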